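(* Let $s,t\in\mathbb{R}^2$ be two distinct fixed points, let $X_n$ be a homogeneous Poisson point process of intensity $n$ in $\mathbb{R}^2$, and let $X:=X_n\cup\{s,t\}$. Let $\ell(SP_X)$ be the Euclidean length of the shortest path $SP_X$ from $s$ to $t$ in the Delaunay triangulation $\operatorname{Del}(X)$. Then $$\liminf_{n\to\infty}\mathbb{E}\left[\frac{\ell(SP_X)}{\|s-t\|}\right]\ge 1+2.47\cdot 10^{-11}.$$
   Context: $\|\cdot\|$ is the Euclidean norm. For a locally finite set $\chi\subset\mathbb{R}^2$ in general position (no three points on a line, no four points on a circle), the Delaunay triangulation $\operatorname{Del}(\chi)$ is the set of edges $[x_i,x_j]$, $1\le i\ne j\le 3$, over all triples $x_1,x_2,x_3\in\chi$ whose circumscribed disk contains no point of $\chi$ in its interior. A path between $s,t\in\chi$ in $\operatorname{Del}(\chi)$ is a finite sequence of segments $[Z_0,Z_1],\dots,[Z_{k-1},Z_k]$ with $Z_0=s$, $Z_k=t$, each segment being an edge of $\operatorname{Del}(\chi)$. The shortest path $SP_X$ is the path between $s$ and $t$ in $\operatorname{Del}(X)$ of minimal Euclidean length. The points $s,t$ are fixed (independent of $n$). *)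

theory Defs
  imports "HOL-Probability.Probability"
begin

definition locally_finite_set :: "'a::metric_space set \<Rightarrow> bool" where
  "locally_finite_set V \<longleftrightarrow> (\<forall>B. bounded B \<longrightarrow> finite (V \<inter> B))"

text \<open>The point process is simple: a realization is a locally finite set of points. The Poisson
  probabilities are written out because \<^const>\<open>poisson_pmf\<close> is specified for positive rates only,
  whereas the rate is 0 here if \<open>B\<close> is a null set or if the intensity is 0 (recall that \<open>0 ^ 0 = 1\<close>).\<close>

definition homogeneous_poisson_process ::
    "'w measure \<Rightarrow> real \<Rightarrow> ('w \<Rightarrow> 'a::euclidean_space set) \<Rightarrow> bool" where
  "homogeneous_poisson_process M \<gamma> X \<longleftrightarrow>
     prob_space M \<and>
     (\<forall>\<omega>\<in>space M. locally_finite_set (X \<omega>)) \<and>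
     (\<forall>B\<in>sets borel. bounded B \<longrightarrow>
        (\<lambda>\<omega>. card (X \<omega> \<inter> B)) \<in> measurable M (count_space UNIV) \<and>
        (\<forall>k. measure M {\<omega>\<in>space M. card (X \<omega> \<inter> B) = k} =
               (\<gamma> * measure lborel B) ^ k / fact k * exp (- (\<gamma> * measure lborel B)))) \<and>
     (\<forall>(I::nat set) B. finite I \<longrightarrow> (\<forall>i\<in>I. B i \<in> sets borel \<and> bounded (B i)) \<longrightarrow>
        disjoint_family_on B I \<longrightarrow>
        prob_space.indep_vars M (\<lambda>_. count_space UNIV) (\<lambda>i \<omega>. card (X \<omega> \<inter> B i)) I)"

text \<open>Three distinct points on a circle are never collinear, so the centre \<open>c\<close> and the radius \<open>r\<close>
  below are the uniquely determined circumcentre and circumradius of \<open>x\<close>, \<open>y\<close>, \<open>z\<close>. The condition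
  is symmetric in the three points, so all three sides of the triangle are included.\<close>

definition Del :: "(real^2) set \<Rightarrow> (real^2) set set" where
  "Del V = {closed_segment x y | x y.
     \<exists>z c r. {x, y, z} \<subseteq> V \<and> distinct [x, y, z] \<and>
       {x, y, z} \<subseteq> sphere c r \<and> ball c r \<inter> V = {}}"

text \<open>A path is represented by the list of its vertices \<open>Z\<^sub>0, \<dots>, Z\<^sub>k\<close>; a segment
  determines its pair of endpoints.\<close>

definition Del_path :: "(real^2) set \<Rightarrow> real^2 \<Rightarrow> real^2 \<Rightarrow> (real^2) list \<Rightarrow> bool" where
  "Del_path V s t Z \<longleftrightarrow>
     Z \<noteq> [] \<and> hd Z = s \<and> last Z = t \<and> successively (\<lambda>x y. closed_segment x y \<in> Del V) Z"

definition polyline_length :: "'a::real_normed_vector list \<Rightarrow> real" where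
  "polyline_length Z = (\<Sum>i<length Z - 1. norm (Z ! Suc i - Z ! i))"

text \<open>If no path of minimal length exists, the value is arbitrary; no convention favours
  long or short paths in that case.\<close>

definition shortest_path :: "(real^2) set \<Rightarrow> real^2 \<Rightarrow> real^2 \<Rightarrow> (real^2) list" where
  "shortest_path V s t = arg_min polyline_length (Del_path V s t)"

end

theory Submission
  imports Defs
begin

text \<open>Work with the unit of length \<open>a = 1 / sqrt n\<close> and cut the plane into strips of width \<open>10 * a\<close>
  perpendicular to the segment from \<open>s\<close> to \<open>t\<close>, each strip into cells of height \<open>a / 500\<close>. A Delaunay path
  crossing a strip either has a vertex in the strip, so that a cell of tiny area is occupied, or crosses it
  with a single edge, and then an empty circumdisk through the ends of the edge makes a region of
  large area empty. Both are unlikely, and independent for different strips. A path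
  of length at most \<open>1 + 1 / 10 ^ 9\<close> times the distance moves so little sideways that the sequence of
  the cells in which it crosses \<open>N\<close> successive strips has total variation at most \<open>2 * N\<close>; there are
  at most \<open>12 ^ N\<close> such sequences, and each of them is realised with probability at most \<open>24 powr (- N)\<close>.
  Hence with probability tending to 1 all paths are longer. On this event a shortest path exists as
  soon as the points are not collinear, because then every vertex has a Delaunay neighbour that is
  closer to \<open>t\<close>.\<close>

section \<open>Shortest paths in Delaunay triangulations\<close>

lemma polyline_length_single [simp]: "polyline_length [x] = 0"
  by (simp add: polyline_length_def)

lemma polyline_length_Cons_Cons [simp]:
  "polyline_length (x # y # zs) = norm (y - x) + polyline_length (y # zs)"
  unfolding polyline_length_def
  by (simp add: sum.lessThan_Suc_shift del: sum.lessThan_Suc)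

lemma polyline_length_nonneg: "0 \<le> polyline_length Z"
  by (simp add: polyline_length_def sum_nonneg)

section \<open>Empty balls and Delaunay edges\<close>

lemma finite_Int_cball: "locally_finite_set V \<Longrightarrow> finite (V \<inter> cball c r)"
  by (simp add: locally_finite_set_def)

text \<open>The terms quadratic in \<open>c\<close> cancel, so that lying inside the sphere about
  \<open>c\<close> through \<open>x\<close> becomes a linear condition on \<open>c\<close>.\<close>

lemma dist_less_iff_inner:
  fixes x z c :: "'a::real_inner"
  shows "dist c z < dist c x \<longleftrightarrow> (norm (z - x))\<^sup>2 < 2 * ((z - x) \<bullet> (c - x))"
proof -
  have "dist c z < dist c x \<longleftrightarrow> (norm (z - c))\<^sup>2 < (norm (x - c))\<^sup>2"
    by (simp add: dist_norm norm_minus_commute)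
      (metis power2_less_imp_less norm_ge_zero power_strict_mono zero_less_numeral)
  also have "\<dots> \<longleftrightarrow> (norm (z - x))\<^sup>2 < 2 * ((z - x) \<bullet> (c - x))"
    by (simp add: power2_norm_eq_inner algebra_simps inner_commute)
  finally show ?thesis .
qed

lemma dist_eq_iff_inner:
  fixes x z c :: "'a::real_inner"
  shows "dist c z = dist c x \<longleftrightarrow> (norm (z - x))\<^sup>2 = 2 * ((z - x) \<bullet> (c - x))"
proof -
  have "dist c z = dist c x \<longleftrightarrow> (norm (z - c))\<^sup>2 = (norm (x - c))\<^sup>2"
    by (simp add: dist_norm norm_minus_commute)
  also have "\<dots> \<longleftrightarrow> (norm (z - x))\<^sup>2 = 2 * ((z - x) \<bullet> (c - x))"
    by (simp add: power2_norm_eq_inner algebra_simps inner_commute)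
  finally show ?thesis .
qed

text \<open>The balls with \<open>x\<close> on their boundary and centre \<open>c + \<mu> *\<^sub>R n\<close> sweep out the open half-space
  \<open>(z - x) \<bullet> n > 0\<close>; the lemma stops the sweep at the first point of \<open>V\<close>.\<close>

lemma empty_ball_sweep:
  fixes V :: "'a::real_inner set"
  assumes V: "locally_finite_set V" and empty: "ball c (dist c x) \<inter> V = {}"
    and w: "w \<in> V" "(w - x) \<bullet> n > 0"
  obtains z \<mu> where "z \<in> V" "(z - x) \<bullet> n > 0" "0 \<le> \<mu>"
    "dist (c + \<mu> *\<^sub>R n) z = dist (c + \<mu> *\<^sub>R n) x"
    "ball (c + \<mu> *\<^sub>R n) (dist (c + \<mu> *\<^sub>R n) x) \<inter> V = {}"
    "2 * \<mu> * ((w - x) \<bullet> n) \<le> (norm (w - x))\<^sup>2 - 2 * ((w - x) \<bullet> (c - x))"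
proof -
  \<comment> \<open>\<open>g z\<close> is the power of \<open>z\<close> with respect to the sphere
    about \<open>c\<close> through \<open>x\<close>, and \<open>m z\<close> is the parameter at
    which the moving sphere reaches \<open>z\<close>.\<close>
  define g where "g z = (norm (z - x))\<^sup>2 - 2 * ((z - x) \<bullet> (c - x))" for z
  define m where "m z = g z / (2 * ((z - x) \<bullet> n))" for z
  have g: "0 \<le> g z" if "z \<in> V" for z
    using that empty dist_less_iff_inner[of c z x] by (auto simp: g_def)
  have inner: "2 * ((z - x) \<bullet> (c + \<mu> *\<^sub>R n - x)) = 2 * ((z - x) \<bullet> (c - x)) + 2 * \<mu> * ((z - x) \<bullet> n)"
    for z \<mu>
    by (simp add: algebra_simps inner_add_right)
  define S where "S = {z \<in> V. (z - x) \<bullet> n > 0 \<and> m z \<le> m w}"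
  \<comment> \<open>Points reached no later than \<open>w\<close> lie in the closed ball at
    parameter \<open>m w\<close>, so only finitely many compete for the minimum.\<close>
  have "S \<subseteq> V \<inter> cball (c + m w *\<^sub>R n) (dist (c + m w *\<^sub>R n) x)"
  proof
    fix z assume "z \<in> S"
    then have z: "z \<in> V" "(z - x) \<bullet> n > 0" "m z \<le> m w" by (auto simp: S_def)
    then have "g z \<le> 2 * m w * ((z - x) \<bullet> n)"
      by (simp add: m_def[of z] field_simps)
    then have "2 * ((x - z) \<bullet> (c + m w *\<^sub>R n - z)) \<le> (norm (x - z))\<^sup>2"
      unfolding g_def using inner[of z "m w"]
      by (simp add: power2_norm_eq_inner algebra_simps inner_commute)
    then show "z \<in> V \<inter> cball (c + m w *\<^sub>R n) (dist (c + m w *\<^sub>R n) x)"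
      using z dist_less_iff_inner[of "c + m w *\<^sub>R n" x z] by (auto simp: not_less[symmetric])
  qed
  then have "finite S"
    using finite_Int_cball[OF V] finite_subset by blast
  moreover have "w \<in> S" using w by (simp add: S_def)
  ultimately obtain z where z: "z \<in> S" and min: "\<And>y. y \<in> S \<Longrightarrow> m z \<le> m y"
    using ex_is_arg_min_if_finite[of S m] by (auto simp: is_arg_min_linorder)
  have zV: "z \<in> V" "(z - x) \<bullet> n > 0" "m z \<le> m w" using z by (auto simp: S_def)
  have mz: "0 \<le> m z" using g[OF zV(1)] zV(2) by (simp add: m_def)
  show ?thesis
  proof
    show "z \<in> V" "(z - x) \<bullet> n > 0" "0 \<le> m z" by fact+
    have "2 * m z * ((z - x) \<bullet> n) = g z" using zV(2) by (simp add: m_def)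
    then show "dist (c + m z *\<^sub>R n) z = dist (c + m z *\<^sub>R n) x"
      unfolding dist_eq_iff_inner inner g_def by simp
    show "ball (c + m z *\<^sub>R n) (dist (c + m z *\<^sub>R n) x) \<inter> V = {}"
    proof (rule ccontr)
      assume "ball (c + m z *\<^sub>R n) (dist (c + m z *\<^sub>R n) x) \<inter> V \<noteq> {}"
      then obtain y where y: "y \<in> V" "dist (c + m z *\<^sub>R n) y < dist (c + m z *\<^sub>R n) x"
        by auto
      then have *: "g y < 2 * m z * ((y - x) \<bullet> n)"
        unfolding dist_less_iff_inner inner g_def by simp
      \<comment> \<open>No point of \<open>V\<close> has negative power at the start, so a point
        inside a later ball lies on the side towards which the centre moves.\<close>
      then have pos: "(y - x) \<bullet> n > 0"
        using g[OF y(1)] mz by (smt (verit) mult_nonneg_nonpos)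
      then have "m y < m z" using * by (simp add: m_def[of y] field_simps)
      then show False using min[of y] y(1) pos zV(3) by (auto simp: S_def)
    qed
    have "2 * m z * ((w - x) \<bullet> n) \<le> 2 * m w * ((w - x) \<bullet> n)"
      using zV(3) w(2) by simp
    also have "\<dots> = g w" using w(2) by (simp add: m_def)
    finally show "2 * m z * ((w - x) \<bullet> n) \<le> (norm (w - x))\<^sup>2 - 2 * ((w - x) \<bullet> (c - x))"
      by (simp add: g_def)
  qed
qed

text \<open>Moving the centre perpendicularly to \<open>y - x\<close> keeps both points on the
  circle. Since \<open>V\<close> is not collinear, one of the two directions sweeps over a point of
  \<open>V\<close>, and the first one met completes an empty circumdisk.\<close>

lemma Del_if_empty_ball:
  fixes V :: "(real^2) set"
  assumes V: "locally_finite_set V" "\<not> collinear V"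
    and xy: "x \<in> V" "y \<in> V" "x \<noteq> y" "dist c y = dist c x" "ball c (dist c x) \<inter> V = {}"
  shows "closed_segment x y \<in> Del V"
proof -
  obtain w n where w: "w \<in> V" "(w - x) \<bullet> n > 0" and n: "(y - x) \<bullet> n = 0"
  proof (cases "\<forall>w\<in>V. \<exists>k. w = x + k *\<^sub>R (y - x)")
    case True
    then show ?thesis using V(2) unfolding collinear_alt by blast
  next
    case False
    then obtain w where w: "w \<in> V" "\<And>k. w \<noteq> x + k *\<^sub>R (y - x)" by blast
    define e where "e = y - x"
    \<comment> \<open>Gram-Schmidt: \<open>n\<close> is the component of \<open>w - x\<close>
      orthogonal to the edge, so it points to the side of \<open>w\<close>.\<close>
    define k where "k = ((w - x) \<bullet> e) / (e \<bullet> e)"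
    define n where "n = w - x - k *\<^sub>R e"
    have "e \<noteq> 0" using xy(3) by (simp add: e_def)
    then have n: "e \<bullet> n = 0"
      by (simp add: n_def k_def inner_diff_right[of e "w - x"] inner_commute)
    have "n \<noteq> 0" using w(2)[of k] by (auto simp: n_def e_def algebra_simps)
    have "w - x = n + k *\<^sub>R e" by (simp add: n_def)
    then have "(w - x) \<bullet> n = n \<bullet> n + k * (e \<bullet> n)"
      by (metis inner_add_left inner_scaleR_left)
    then have "(w - x) \<bullet> n > 0" using n \<open>n \<noteq> 0\<close> by simp
    then show ?thesis using that w n by (auto simp: e_def)
  qed
  obtain z \<mu> where z: "z \<in> V" "(z - x) \<bullet> n > 0"
    "dist (c + \<mu> *\<^sub>R n) z = dist (c + \<mu> *\<^sub>R n) x"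
    "ball (c + \<mu> *\<^sub>R n) (dist (c + \<mu> *\<^sub>R n) x) \<inter> V = {}"
    using empty_ball_sweep[OF V(1) xy(5) w] by metis
  have "dist (c + \<mu> *\<^sub>R n) y = dist (c + \<mu> *\<^sub>R n) x"
    using xy(4) n unfolding dist_eq_iff_inner by (simp add: inner_diff_right inner_add_right)
  then have "{x, y, z} \<subseteq> sphere (c + \<mu> *\<^sub>R n) (dist (c + \<mu> *\<^sub>R n) x)"
    using z(3) by simp
  moreover have "distinct [x, y, z]" using xy(3) z(2) n by auto
  ultimately show ?thesis
    unfolding Del_def using xy(1,2) z(1,4) by blast
qed

text \<open>Grow a ball from the single point \<open>x\<close>, its centre moving towards
  \<open>t\<close>. It stops at the latest on reaching \<open>t\<close>, so it lies in the closed
  ball about \<open>t\<close> through \<open>x\<close> and touches that sphere only at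
  \<open>x\<close>; the point that stops it is therefore closer to \<open>t\<close>.\<close>

lemma Del_neighbour_closer:
  fixes V :: "(real^2) set"
  assumes V: "locally_finite_set V" "\<not> collinear V" and xt: "x \<in> V" "t \<in> V" "x \<noteq> t"
  obtains y where "y \<in> V" "dist y t < dist x t" "closed_segment x y \<in> Del V"
proof -
  obtain y \<mu> where y: "y \<in> V" "(y - x) \<bullet> (t - x) > 0" "0 \<le> \<mu>"
    "dist (x + \<mu> *\<^sub>R (t - x)) y = dist (x + \<mu> *\<^sub>R (t - x)) x"
    "ball (x + \<mu> *\<^sub>R (t - x)) (dist (x + \<mu> *\<^sub>R (t - x)) x) \<inter> V = {}"
    "2 * \<mu> * ((t - x) \<bullet> (t - x)) \<le> (norm (t - x))\<^sup>2 - 2 * ((t - x) \<bullet> (x - x))"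
    by (rule empty_ball_sweep[OF V(1), of x x t "t - x"]) (use xt in auto)
  have "2 * \<mu> \<le> 1"
    using y(6) xt(3) by (simp add: power2_norm_eq_inner)
  then have "2 * \<mu> * ((y - x) \<bullet> (t - x)) \<le> (y - x) \<bullet> (t - x)"
    using y(2) by simp
  moreover have "(norm (y - x))\<^sup>2 = 2 * \<mu> * ((y - x) \<bullet> (t - x))"
    using y(4) unfolding dist_eq_iff_inner by simp
  moreover have "0 < (norm (y - x))\<^sup>2" using y(2) by auto
  ultimately have "(norm (y - x))\<^sup>2 < 2 * ((y - x) \<bullet> (t - x))" using y(2) by linarith
  then have "dist t y < dist t x" by (simp add: dist_less_iff_inner)
  moreover have "x \<noteq> y" using y(2) by auto
  then have "closed_segment x y \<in> Del V"
    using Del_if_empty_ball[OF V xt(1) y(1) _ y(4,5)] by simp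
  ultimately show ?thesis using that y(1) by (simp add: dist_commute)
qed

text \<open>Keep stepping to a closer neighbour: the number of points of \<open>V\<close> that are
  closer to \<open>t\<close> is finite and drops each time.\<close>

lemma Del_path_exists:
  fixes V :: "(real^2) set"
  assumes V: "locally_finite_set V" "\<not> collinear V" and t: "t \<in> V"
  shows "x \<in> V \<Longrightarrow> \<exists>Z. Del_path V x t Z"
proof (induction "card (V \<inter> {z. dist z t < dist x t})" arbitrary: x rule: less_induct)
  case less
  show ?case
  proof (cases "x = t")
    case True
    then have "Del_path V x t [x]" by (simp add: Del_path_def)
    then show ?thesis by blast
  next
    case False
    then obtain y where y: "y \<in> V" "dist y t < dist x t" "closed_segment x y \<in> Del V"
      using Del_neighbour_closer[OF V less.prems t] by metis
    have "V \<inter> {z. dist z t < dist x t} \<subseteq> V \<inter> cball t (dist x t)"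
      by (auto simp: dist_commute)
    then have "finite (V \<inter> {z. dist z t < dist x t})"
      using finite_Int_cball[OF V(1)] finite_subset by blast
    moreover have "V \<inter> {z. dist z t < dist y t} \<subset> V \<inter> {z. dist z t < dist x t}"
      using y by auto
    ultimately have "card (V \<inter> {z. dist z t < dist y t}) < card (V \<inter> {z. dist z t < dist x t})"
      by (rule psubset_card_mono)
    then obtain Z where Z: "Del_path V y t Z" using less.hyps y(1) by blast
    then have "Del_path V x t (x # Z)"
      using y(3) by (cases Z) (auto simp: Del_path_def)
    then show ?thesis by blast
  qed
qed

section \<open>Existence of a shortest path\<close>

lemma Del_edge:
  assumes "closed_segment x y \<in> Del V"
  obtains c r where "x \<in> V" "y \<in> V" "x \<noteq> y" "dist c x = r" "dist c y = r" "ball c r \<inter> V = {}"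
proof -
  obtain x' y' z c r where *: "closed_segment x y = closed_segment x' y'" "{x', y', z} \<subseteq> V"
    "distinct [x', y', z]" "{x', y', z} \<subseteq> sphere c r" "ball c r \<inter> V = {}"
    using assms unfolding Del_def mem_Collect_eq by (elim exE conjE)
  then have "x = x' \<and> y = y' \<or> x = y' \<and> y = x'" by (simp add: doubleton_eq_iff)
  then show ?thesis
  proof
    assume "x = x' \<and> y = y'"
    then show ?thesis using * by (intro that[of c r]) simp_all
  next
    assume "x = y' \<and> y = x'"
    then show ?thesis using * by (intro that[of c r]) auto
  qed
qed

lemma Del_path_vertices:
  assumes "Del_path V s t Z" "s \<in> V"
  shows "set Z \<subseteq> V"
  using assms
proof (induction Z arbitrary: s)
  case (Cons x Z)
  show ?case
  proof (cases Z)
    case (Cons y Z')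
    then have "closed_segment x y \<in> Del V" "Del_path V y t Z"
      using Cons.prems by (auto simp: Del_path_def)
    moreover from this(1) have "x \<in> V \<and> y \<in> V" by (rule Del_edge) simp
    ultimately show ?thesis using Cons.IH[of y] by simp
  qed (use Cons.prems in \<open>auto simp: Del_path_def\<close>)
qed simp

lemma dist_le_polyline_length:
  assumes "x \<in> set Z"
  shows "dist (hd Z) x \<le> polyline_length Z"
  using assms
proof (induction Z)
  case (Cons a Z)
  show ?case
  proof (cases Z)
    case (Cons b Z')
    then have len: "polyline_length (a # Z) = dist a b + polyline_length Z"
      by (simp add: dist_norm norm_minus_commute)
    show ?thesis
    proof (cases "x = a")
      case False
      then have "dist b x \<le> polyline_length Z" using Cons.prems Cons.IH Cons by simp
      then show ?thesis using len dist_triangle[of a x b] by simp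
    qed (simp add: polyline_length_nonneg)
  qed (use Cons.prems in auto)
qed simp

lemma length_le_polyline_length:
  assumes "\<And>x y. x \<in> F \<Longrightarrow> y \<in> F \<Longrightarrow> x \<noteq> y \<Longrightarrow> \<delta> \<le> dist x y"
    and "set Z \<subseteq> F" "successively (\<noteq>) Z" "Z \<noteq> []"
  shows "real (length Z - 1) * \<delta> \<le> polyline_length Z"
  using assms(2-4)
proof (induction Z)
  case (Cons a Z)
  show ?case
  proof (cases Z)
    case (Cons b Z')
    then have "\<delta> \<le> dist a b" using Cons.prems by (intro assms(1)) auto
    moreover have "real (length Z - 1) * \<delta> \<le> polyline_length Z"
      using Cons.prems Cons by (intro Cons.IH) auto
    ultimately show ?thesis using Cons
      by (simp add: dist_norm norm_minus_commute algebra_simps)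
  qed (use Cons.prems in auto)
qed simp

text \<open>A path of length at most \<open>l\<close> stays in the finite set \<open>F\<close>, and
  each of its edges has length at least \<open>\<delta>\<close>, which bounds the number of
  vertices.\<close>

lemma finite_short_Del_paths:
  assumes V: "locally_finite_set V" and s: "s \<in> V"
  shows "finite {Z. Del_path V s t Z \<and> polyline_length Z \<le> l}"
proof -
  define F where "F = V \<inter> cball s l"
  have F: "finite F" unfolding F_def by (rule finite_Int_cball[OF V])
  \<comment> \<open>The inserted 1 keeps \<open>D\<close> nonempty when \<open>F\<close> has fewer
    than two points.\<close>
  define D where "D = insert 1 ((\<lambda>(x, y). dist x y) ` (F \<times> F - Id))"
  have D: "finite D" "D \<noteq> {}"
    unfolding D_def using F by simp_all
  define \<delta> where "\<delta> = Min D"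
  have "0 < d" if "d \<in> D" for d using that unfolding D_def by auto
  then have pos: "0 < \<delta>" unfolding \<delta>_def using D by simp
  have le: "\<delta> \<le> dist x y" if "x \<in> F" "y \<in> F" "x \<noteq> y" for x y
    unfolding \<delta>_def using that D by (intro Min_le) (auto simp: D_def)
  have "{Z. Del_path V s t Z \<and> polyline_length Z \<le> l}
      \<subseteq> {Z. set Z \<subseteq> F \<and> length Z \<le> nat \<lceil>l / \<delta>\<rceil> + 1}"
  proof safe
    fix Z assume Z: "Del_path V s t Z" "polyline_length Z \<le> l"
    then have hd: "Z \<noteq> []" "hd Z = s" and succ: "successively (\<lambda>x y. closed_segment x y \<in> Del V) Z"
      by (auto simp: Del_path_def)
    show sub: "x \<in> F" if "x \<in> set Z" for x
      using dist_le_polyline_length[OF that] Del_path_vertices[OF Z(1) s] hd Z(2) that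
      by (auto simp: F_def)
    have "successively (\<noteq>) Z"
      using succ by (rule successively_mono) (auto elim: Del_edge)
    then have "real (length Z - 1) * \<delta> \<le> l"
      using length_le_polyline_length[of F \<delta> Z] le sub hd(1) Z(2) by force
    then have "real (length Z - 1) \<le> l / \<delta>" using pos by (simp add: field_simps)
    then show "length Z \<le> nat \<lceil>l / \<delta>\<rceil> + 1" by linarith
  qed
  then show ?thesis using finite_lists_length_le[OF F] finite_subset by blast
qed

text \<open>A minimiser over the finitely many paths no longer than a given one is a minimiser over
  all paths, so \<open>arg_min\<close> does not return an arbitrary value here.\<close>

lemma Del_path_shortest_path:
  fixes V :: "(real^2) set"
  assumes "locally_finite_set V" "\<not> collinear V" "s \<in> V" "t \<in> V"
  shows "Del_path V s t (shortest_path V s t)"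
proof -
  obtain Z where Z: "Del_path V s t Z" using Del_path_exists assms by blast
  define S where "S = {Z'. Del_path V s t Z' \<and> polyline_length Z' \<le> polyline_length Z}"
  have "finite S" "S \<noteq> {}"
    using finite_short_Del_paths[OF assms(1,3)] Z by (auto simp: S_def)
  then obtain Y where "is_arg_min polyline_length (\<lambda>Y. Y \<in> S) Y"
    using ex_is_arg_min_if_finite by blast
  then have "Del_path V s t Y" "\<And>Y'. Del_path V s t Y' \<Longrightarrow> \<not> polyline_length Y' < polyline_length Y"
    by (force simp: S_def is_arg_min_linorder)+
  then show ?thesis unfolding shortest_path_def by (rule arg_minI)
qed

section \<open>Crossing strips\<close>

locale orthonormal_frame =
  fixes s u v :: "real^2"
  assumes norm_u: "norm u = 1" and norm_v: "norm v = 1" and u_v: "u \<bullet> v = 0"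
begin

definition xcoord :: "real^2 \<Rightarrow> real" where "xcoord z = (z - s) \<bullet> u"

definition ycoord :: "real^2 \<Rightarrow> real" where "ycoord z = (z - s) \<bullet> v"

text \<open>Half-open, so that rectangles sharing a side are disjoint.\<close>

definition rect :: "real \<Rightarrow> real \<Rightarrow> real \<Rightarrow> real \<Rightarrow> (real^2) set" where
  "rect a b c d = {z. a \<le> xcoord z \<and> xcoord z < b \<and> c \<le> ycoord z \<and> ycoord z < d}"

definition frame_map :: "real^2 \<Rightarrow> real^2" where
  "frame_map p = (p $ 1) *\<^sub>R u + (p $ 2) *\<^sub>R v"

lemma frame_inner [simp]: "u \<bullet> u = 1" "v \<bullet> v = 1" "u \<bullet> v = 0" "v \<bullet> u = 0"
  using norm_u norm_v u_v by (simp_all add: norm_eq_1 inner_commute)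

lemma orthogonal_frame_map: "orthogonal_transformation frame_map"
proof -
  have "linear frame_map"
    by (rule linearI) (simp_all add: frame_map_def algebra_simps)
  moreover have "frame_map p \<bullet> frame_map q = p \<bullet> q" for p q
  proof -
    have "p \<bullet> q = p $ 1 * q $ 1 + p $ 2 * q $ 2" by (simp add: inner_vec_def sum_2)
    then show ?thesis by (simp add: frame_map_def inner_add_left inner_add_right)
  qed
  ultimately show ?thesis by (simp add: orthogonal_transformation_def)
qed

text \<open>Orthogonal maps of the plane are surjective, so \<open>u\<close> and \<open>v\<close>
  span it.\<close>

lemma frame_decomp: "z = (z \<bullet> u) *\<^sub>R u + (z \<bullet> v) *\<^sub>R v"
proof -
  obtain p where p: "z = frame_map p"
    using orthogonal_transformation_surj[OF orthogonal_frame_map] by (metis surjD)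
  show ?thesis by (simp add: p frame_map_def inner_add_left)
qed

lemma inner_frame: "a \<bullet> b = (a \<bullet> u) * (b \<bullet> u) + (a \<bullet> v) * (b \<bullet> v)"
proof -
  have "a \<bullet> b = ((a \<bullet> u) *\<^sub>R u + (a \<bullet> v) *\<^sub>R v) \<bullet> b"
    by (simp flip: frame_decomp)
  then show ?thesis by (simp add: inner_add_right inner_commute)
qed

lemma rect_eq_image:
  "rect a b c d = (\<lambda>z. s + z) ` (frame_map ` {p. a \<le> p $ 1 \<and> p $ 1 < b \<and> c \<le> p $ 2 \<and> p $ 2 < d})"
    (is "_ = _ ` (_ ` ?S)")
proof safe
  fix z assume z: "z \<in> rect a b c d"
  define p :: "real^2" where "p = vector [xcoord z, ycoord z]"
  have "p \<in> ?S" using z by (simp add: p_def rect_def vector_2)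
  moreover have "z = s + frame_map p"
    using frame_decomp[of "z - s"]
    by (simp add: p_def frame_map_def vector_2 xcoord_def ycoord_def algebra_simps)
  ultimately show "z \<in> (\<lambda>z. s + z) ` (frame_map ` ?S)" by blast
next
  fix p :: "real^2" assume "a \<le> p $ 1" "p $ 1 < b" "c \<le> p $ 2" "p $ 2 < d"
  then show "s + frame_map p \<in> rect a b c d"
    by (simp add: rect_def xcoord_def ycoord_def frame_map_def inner_add_left)
qed

lemma continuous_coord: "continuous_on A xcoord" "continuous_on A ycoord"
  unfolding xcoord_def[abs_def] ycoord_def[abs_def] by (intro continuous_intros)+

lemma rect_borel [measurable]: "rect a b c d \<in> sets borel"
proof -
  have [measurable]: "xcoord \<in> borel_measurable borel" "ycoord \<in> borel_measurable borel"
    by (intro borel_measurable_continuous_onI continuous_coord)+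
  show ?thesis unfolding rect_def by measurable
qed

lemma bounded_rect: "bounded (rect a b c d)"
proof -
  have "norm z \<le> norm s + (\<bar>a\<bar> + \<bar>b\<bar> + \<bar>c\<bar> + \<bar>d\<bar>)" if "z \<in> rect a b c d" for z
  proof -
    have "z - s = xcoord z *\<^sub>R u + ycoord z *\<^sub>R v"
      using frame_decomp[of "z - s"] by (simp add: xcoord_def ycoord_def)
    then have "norm (z - s) \<le> \<bar>xcoord z\<bar> + \<bar>ycoord z\<bar>"
      by (metis norm_triangle_ineq norm_scaleR norm_u norm_v mult.right_neutral)
    moreover have "\<bar>xcoord z\<bar> + \<bar>ycoord z\<bar> \<le> \<bar>a\<bar> + \<bar>b\<bar> + \<bar>c\<bar> + \<bar>d\<bar>"
      using that by (simp add: rect_def abs_le_iff) linarith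
    ultimately show ?thesis using norm_triangle_ineq[of s "z - s"] by simp
  qed
  then show ?thesis by (auto simp: bounded_iff)
qed

text \<open>The half-open rectangle lies between an open and a closed box of equal volume;
  translations and orthogonal maps preserve the volume.\<close>

lemma measure_rect:
  assumes "a \<le> b" "c \<le> d"
  shows "measure lborel (rect a b c d) = (b - a) * (d - c)"
proof -
  define S :: "(real^2) set" where "S = {p. a \<le> p $ 1 \<and> p $ 1 < b \<and> c \<le> p $ 2 \<and> p $ 2 < d}"
  define l h :: "real^2" where "l = vector [a, c]" and "h = vector [b, d]"
  have S: "S \<in> sets borel" unfolding S_def by measurable
  have sub: "box l h \<subseteq> S" "S \<subseteq> cbox l h"
    by (auto simp: S_def l_def h_def mem_box_cart forall_2 vector_2)
  have fin: "S \<in> lmeasurable"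
    using S sub(2) bounded_subset[OF bounded_cbox] by (intro bounded_set_imp_lmeasurable) auto
  have le: "l \<bullet> i \<le> h \<bullet> i" if "i \<in> Basis" for i
    using that assms by (auto simp: Basis_vec_def l_def h_def inner_axis UNIV_2 vector_2)
  then have "l \<in> cbox l h" by (simp add: mem_box)
  then have "measure lborel (cbox l h) = (b - a) * (d - c)"
    by (subst content_cbox_cart) (auto simp: l_def h_def vector_2 UNIV_2)
  moreover have "measure lborel (box l h) = measure lborel (cbox l h)"
    using le by simp
  ultimately have vol: "measure lebesgue (box l h) = (b - a) * (d - c)"
      "measure lebesgue (cbox l h) = (b - a) * (d - c)"
    by simp_all
  have "measure lebesgue S = (b - a) * (d - c)"
    using measure_mono_fmeasurable[OF sub(1) _ fin] measure_mono_fmeasurable[OF sub(2), of lebesgue]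
      fmeasurableD[OF fin] vol by simp
  moreover have "measure lborel (rect a b c d) = measure lebesgue (rect a b c d)"
    by (rule measure_completion[symmetric]) (simp add: rect_borel)
  moreover have "measure lebesgue (rect a b c d) = measure lebesgue S"
    unfolding rect_eq_image S_def[symmetric]
    by (simp add: measure_translation measure_orthogonal_image[OF orthogonal_frame_map fin])
  ultimately show ?thesis by simp
qed

text \<open>The coordinate increments are added up as vectors in the plane, realised as complex numbers.\<close>

lemma polyline_length_ge:
  fixes Z :: "(real^2) list"
  shows "(\<Sum>i<length Z - 1. \<bar>xcoord (Z ! Suc i) - xcoord (Z ! i)\<bar>)\<^sup>2
       + (\<Sum>i<length Z - 1. \<bar>ycoord (Z ! Suc i) - ycoord (Z ! i)\<bar>)\<^sup>2 \<le> (polyline_length Z)\<^sup>2"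
proof -
  define \<Delta> where "\<Delta> i = Complex \<bar>xcoord (Z ! Suc i) - xcoord (Z ! i)\<bar> \<bar>ycoord (Z ! Suc i) - ycoord (Z ! i)\<bar>" for i
  have "norm (\<Delta> i) = norm (Z ! Suc i - Z ! i)" for i
    unfolding \<Delta>_def complex_norm norm_eq_sqrt_inner[of "Z ! Suc i - Z ! i"] complex.sel
    by (subst inner_frame) (simp add: xcoord_def ycoord_def inner_diff_left power2_eq_square[symmetric])
  then have "norm (\<Sum>i<length Z - 1. \<Delta> i) \<le> polyline_length Z"
    unfolding polyline_length_def by (metis (no_types, lifting) norm_sum sum.cong)
  then have "(norm (\<Sum>i<length Z - 1. \<Delta> i))\<^sup>2 \<le> (polyline_length Z)\<^sup>2"
    by (simp add: power_mono)
  then show ?thesis by (simp add: cmod_power2 \<Delta>_def)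
qed

end

text \<open>Points \<open>(e, \<theta>)\<close> of a polygonal line (the point at parameter \<open>\<theta>\<close> of the \<open>e\<close>-th segment) are
  ordered lexicographically; \<open>F\<close> below is the variation accumulated up to such a point.\<close>

lemma sampled_variation_le:
  fixes y \<theta> :: "nat \<Rightarrow> real" and e :: "nat \<Rightarrow> nat"
  assumes \<theta>: "\<And>k. k \<le> N \<Longrightarrow> 0 \<le> \<theta> k \<and> \<theta> k \<le> 1"
    and e: "\<And>k. k \<le> N \<Longrightarrow> e k < m"
    and mono: "\<And>k. k < N \<Longrightarrow> e k < e (Suc k) \<or> e k = e (Suc k) \<and> \<theta> k \<le> \<theta> (Suc k)"
  defines "P \<equiv> \<lambda>k. y (e k) + \<theta> k * (y (Suc (e k)) - y (e k))"
  shows "(\<Sum>k<N. \<bar>P (Suc k) - P k\<bar>) \<le> (\<Sum>i<m. \<bar>y (Suc i) - y i\<bar>)"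
proof -
  define V where "V n = (\<Sum>i<n. \<bar>y (Suc i) - y i\<bar>)" for n
  define F where "F k = V (e k) + \<theta> k * \<bar>y (Suc (e k)) - y (e k)\<bar>" for k
  have V: "\<bar>y j - y i\<bar> \<le> V j - V i" if "i \<le> j" for i j
    using that by (induction j rule: dec_induct) (auto simp: V_def)
  have V_mono: "V i \<le> V j" if "i \<le> j" for i j
    using V[OF that] by linarith
  have step: "\<bar>P (Suc k) - P k\<bar> \<le> F (Suc k) - F k" if k: "k < N" for k
    using mono[OF k]
  proof
    assume "e k = e (Suc k) \<and> \<theta> k \<le> \<theta> (Suc k)"
    then show ?thesis
      by (simp add: P_def F_def flip: left_diff_distrib) (simp add: abs_mult)
  next
    assume less: "e k < e (Suc k)"
    define A where "A = y (Suc (e k)) - y (e k)"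
    define B where "B = y (Suc (e (Suc k))) - y (e (Suc k))"
    \<comment> \<open>The way from one sample to the next consists of the rest of segment
      \<open>e k\<close>, whole segments, and the beginning of segment
      \<open>e (Suc k)\<close>.\<close>
    have "P (Suc k) - P k = (1 - \<theta> k) * A + (y (e (Suc k)) - y (Suc (e k))) + \<theta> (Suc k) * B"
      by (simp add: P_def A_def B_def algebra_simps)
    also have "\<bar>\<dots>\<bar> \<le> (1 - \<theta> k) * \<bar>A\<bar> + (V (e (Suc k)) - V (Suc (e k))) + \<theta> (Suc k) * \<bar>B\<bar>"
      using \<theta>[of k] \<theta>[of "Suc k"] k V[of "Suc (e k)" "e (Suc k)"] less
        abs_mult[of "1 - \<theta> k" A] abs_mult[of "\<theta> (Suc k)" B] by (simp add: abs_le_iff) linarith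
    also have "\<dots> = F (Suc k) - F k"
      by (simp add: F_def A_def B_def V_def algebra_simps)
    finally show ?thesis .
  qed
  have "(\<Sum>k<N. \<bar>P (Suc k) - P k\<bar>) \<le> (\<Sum>k<N. F (Suc k) - F k)"
    by (intro sum_mono step) simp
  also have "\<dots> = F N - F 0" by (rule sum_lessThan_telescope)
  also have "\<dots> \<le> F N"
  proof -
    have "0 \<le> F 0"
      unfolding F_def V_def using \<theta>[of 0] by (intro add_nonneg_nonneg mult_nonneg_nonneg sum_nonneg) auto
    then show ?thesis by simp
  qed
  also have "\<dots> \<le> V (Suc (e N))"
    using \<theta>[of N] by (simp add: F_def V_def mult_left_le_one_le)
  also have "\<dots> \<le> V m" using e[of N] by (intro V_mono) simp
  finally show ?thesis by (simp add: V_def)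
qed

section \<open>Strips and the regions of a crossing\<close>

context orthonormal_frame
begin

text \<open>The \<open>k\<close>-th strip is \<open>10 * a * (real k + 1) \<le> x < 10 * a * (real k + 2)\<close>,
  it is divided into cells of height \<open>a / 500\<close>. The region \<open>None\<close> is a cell; \<open>Some (p, q)\<close> is a
  rectangle with side lengths \<open>3 * a\<close> and \<open>3 * a - a / 500\<close>, on the side given by the signs \<open>p\<close>, \<open>q\<close>
  of any point of the cell on the axis of the strip.\<close>

definition region :: "real \<Rightarrow> nat \<Rightarrow> int \<Rightarrow> (bool \<times> bool) option \<Rightarrow> (real^2) set" where
  "region a k c \<tau> = (case \<tau> of
     None \<Rightarrow> rect (10 * a * (real k + 1)) (10 * a * (real k + 2)) (c * (a / 500)) ((real_of_int c + 1) * (a / 500))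
   | Some (p, q) \<Rightarrow> rect (10 * a * (real k + 1) + 5 * a - (if p then 0 else 3 * a))
       (10 * a * (real k + 1) + 5 * a + (if p then 3 * a else 0))
       (if q then (real_of_int c + 1) * (a / 500) else (real_of_int c + 1) * (a / 500) - 3 * a)
       (if q then c * (a / 500) + 3 * a else c * (a / 500)))"

text \<open>Both ways of crossing a strip are cast as one void event with a prescribed truth value,
  so that independence treats them alike.\<close>

definition consistent :: "(real^2) set \<Rightarrow> real \<Rightarrow> nat \<Rightarrow> int \<Rightarrow> (bool \<times> bool) option \<Rightarrow> bool" where
  "consistent X a k c \<tau> \<longleftrightarrow> (X \<inter> region a k c \<tau> = {} \<longleftrightarrow> \<tau> \<noteq> None)"

lemma region_borel: "region a k c \<tau> \<in> sets borel"
  by (simp add: region_def rect_borel split: option.split)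

lemma bounded_region: "bounded (region a k c \<tau>)"
  by (simp add: region_def bounded_rect split: option.split)

lemma xcoord_region:
  assumes "0 < a" "z \<in> region a k c \<tau>"
  shows "10 * a * (real k + 1) \<le> xcoord z" "xcoord z < 10 * a * (real k + 2)"
  using assms by (auto simp: region_def rect_def algebra_simps split: option.splits if_splits)

text \<open>Each region stays inside its own strip, whatever the cell and the type; this gives the
  independence of the counts in different strips.\<close>

lemma disjoint_regions:
  assumes "0 < a"
  shows "disjoint_family_on (\<lambda>k. region a k (c k) (\<tau> k)) I"
proof -
  have "region a i (c i) (\<tau> i) \<inter> region a j (c j) (\<tau> j) = {}" if "i < j" for i j
  proof (rule ccontr)
    assume "region a i (c i) (\<tau> i) \<inter> region a j (c j) (\<tau> j) \<noteq> {}"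
    then obtain z where z: "z \<in> region a i (c i) (\<tau> i)" "z \<in> region a j (c j) (\<tau> j)" by blast
    have "real i + 2 \<le> real j + 1" using that by linarith
    then have "10 * a * (real i + 2) \<le> 10 * a * (real j + 1)"
      using assms by (intro mult_left_mono) auto
    then show False
      using xcoord_region(2)[OF assms z(1)] xcoord_region(1)[OF assms z(2)] by linarith
  qed
  then show ?thesis
    unfolding disjoint_family_on_def by (metis inf_commute linorder_neqE_nat)
qed

lemma measure_region_None:
  assumes "0 < a"
  shows "measure lborel (region a k c None) = a\<^sup>2 / 50"
  unfolding region_def option.case using assms
  by (subst measure_rect) (auto simp: algebra_simps power2_eq_square divide_simps)

lemma measure_region_Some:
  assumes "0 < a"
  shows "8 * a\<^sup>2 \<le> measure lborel (region a k c (Some pq))"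
proof -
  obtain p q where "pq = (p, q)" by fastforce
  then have "measure lborel (region a k c (Some pq)) = 3 * a * (3 * a - a / 500)"
    unfolding region_def option.case \<open>pq = (p, q)\<close> prod.case using assms
    by (subst measure_rect) (auto simp: algebra_simps)
  \<comment> \<open>The factor on the right is 3 * (3 - 1 / 500) = 8.994.\<close>
  also have "8 * a\<^sup>2 \<le> \<dots>" by (simp add: power2_eq_square algebra_simps)
  finally show ?thesis by simp
qed

text \<open>The disk of radius \<open>5 * a\<close> about the crossing point \<open>m\<close> of the edge with the axis of the strip
  is cut in two halves by the line through \<open>m\<close> perpendicular to \<open>c - m\<close>. By the power of the point
  \<open>m\<close>, the half facing \<open>c\<close> lies in the empty circumdisk, and it contains the quarter disk in the
  quadrant of \<open>c - m\<close>.\<close>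

lemma crossing_edge_empty_region:
  assumes a: "0 < a" and xy: "dist c x = r" "dist c y = r" "ball c r \<inter> V = {}"
    and cross: "xcoord x \<le> 10 * a * (real k + 1)" "10 * a * (real k + 2) \<le> xcoord y"
    and \<theta>: "\<theta> = (10 * a * (real k + 1) + 5 * a - xcoord x) / (xcoord y - xcoord x)"
  shows "\<exists>pq. V \<inter> region a k \<lfloor>(ycoord x + \<theta> * (ycoord y - ycoord x)) / (a / 500)\<rfloor> (Some pq) = {}"
proof -
  define m where "m = x + \<theta> *\<^sub>R (y - x)"
  define j where "j = \<lfloor>ycoord m / (a / 500)\<rfloor>"
  define \<Delta> where "\<Delta> = xcoord y - xcoord x"
  have \<Delta>: "10 * a \<le> \<Delta>" using cross by (simp add: \<Delta>_def algebra_simps)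
  then have "\<Delta> > 0" using a by linarith
  then have \<theta>\<Delta>: "\<theta> * \<Delta> = 10 * a * (real k + 1) + 5 * a - xcoord x"
    by (simp add: \<theta> \<Delta>_def)
  have xm: "xcoord m = 10 * a * (real k + 1) + 5 * a"
    using \<theta>\<Delta> by (simp add: m_def xcoord_def \<Delta>_def inner_diff_left inner_add_left algebra_simps)
  have ym: "ycoord m = ycoord x + \<theta> * (ycoord y - ycoord x)"
    by (simp add: m_def ycoord_def inner_diff_left inner_add_left)
  have j: "j * (a / 500) \<le> ycoord m" "ycoord m < (real_of_int j + 1) * (a / 500)"
  proof -
    have "j \<le> ycoord m / (a / 500)" "ycoord m / (a / 500) < real_of_int j + 1"
      unfolding j_def by linarith+
    then show "j * (a / 500) \<le> ycoord m" "ycoord m < (real_of_int j + 1) * (a / 500)"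
      using a by (simp_all add: field_simps)
  qed
  have power: "(norm (m - c))\<^sup>2 \<le> r\<^sup>2 - 25 * a\<^sup>2"
  proof -
    have "(norm (x - c))\<^sup>2 = r\<^sup>2" "(norm (y - c))\<^sup>2 = r\<^sup>2"
      using xy by (simp_all add: dist_norm norm_minus_commute)
    then have "2 * ((x - c) \<bullet> (y - x)) = - ((y - x) \<bullet> (y - x))"
      by (simp add: power2_norm_eq_inner algebra_simps inner_commute)
    moreover have "(norm (m - c))\<^sup>2
        = (norm (x - c))\<^sup>2 + \<theta> * (2 * ((x - c) \<bullet> (y - x))) + \<theta>\<^sup>2 * ((y - x) \<bullet> (y - x))"
    proof -
      have "m - c = (x - c) + \<theta> *\<^sub>R (y - x)" by (simp add: m_def)
      moreover have "(norm (p + \<theta> *\<^sub>R q))\<^sup>2 = (norm p)\<^sup>2 + \<theta> * (2 * (p \<bullet> q)) + \<theta>\<^sup>2 * (q \<bullet> q)"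
        for p q :: "real^2"
        unfolding power2_norm_eq_inner
        by (simp add: inner_add_left inner_add_right inner_commute power2_eq_square)
      ultimately show ?thesis by (simp only:)
    qed
    ultimately have "(norm (m - c))\<^sup>2 = r\<^sup>2 - \<theta> * (1 - \<theta>) * ((y - x) \<bullet> (y - x))"
    proof -
      assume "2 * ((x - c) \<bullet> (y - x)) = - ((y - x) \<bullet> (y - x))"
        "(norm (m - c))\<^sup>2 = (norm (x - c))\<^sup>2 + \<theta> * (2 * ((x - c) \<bullet> (y - x))) + \<theta>\<^sup>2 * ((y - x) \<bullet> (y - x))"
      moreover have "R + \<theta> * (- E) + \<theta>\<^sup>2 * E = R - \<theta> * (1 - \<theta>) * E" for R E :: real
        by (simp add: algebra_simps power2_eq_square)
      ultimately show ?thesis by (simp only: \<open>(norm (x - c))\<^sup>2 = r\<^sup>2\<close>)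
    qed
    moreover have "25 * a\<^sup>2 \<le> \<theta> * (1 - \<theta>) * ((y - x) \<bullet> (y - x))"
    proof -
      \<comment> \<open>The axis is \<open>5 * a\<close> away from both sides of the strip and the
        edge spans the strip, so each of its two parts advances at least \<open>5 * a\<close> along
        \<open>u\<close>.\<close>
      have 1: "5 * a \<le> \<theta> * \<Delta>" using \<theta>\<Delta> cross by simp
      have 2: "5 * a \<le> (1 - \<theta>) * \<Delta>" using \<theta>\<Delta> cross by (simp add: \<Delta>_def algebra_simps)
      have "0 \<le> \<theta> * \<Delta>" "0 \<le> (1 - \<theta>) * \<Delta>" using 1 2 a by linarith+
      then have "0 \<le> \<theta>" "0 \<le> 1 - \<theta>"
        using \<open>\<Delta> > 0\<close> by (simp_all add: zero_le_mult_iff)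
      have "25 * a\<^sup>2 = (5 * a) * (5 * a)" by (simp add: power2_eq_square)
      also have "\<dots> \<le> (\<theta> * \<Delta>) * ((1 - \<theta>) * \<Delta>)" using 1 2 a by (intro mult_mono[of _ _ "5 * a"]) linarith+
      also have "\<dots> = \<theta> * (1 - \<theta>) * \<Delta>\<^sup>2" by (simp add: power2_eq_square)
      also have "\<Delta>\<^sup>2 \<le> (y - x) \<bullet> (y - x)"
        by (subst inner_frame) (simp add: \<Delta>_def xcoord_def inner_diff_left power2_eq_square)
      then have "\<theta> * (1 - \<theta>) * \<Delta>\<^sup>2 \<le> \<theta> * (1 - \<theta>) * ((y - x) \<bullet> (y - x))"
        using \<open>0 \<le> \<theta>\<close> \<open>0 \<le> 1 - \<theta>\<close> by (intro mult_left_mono) auto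
      finally show ?thesis .
    qed
    ultimately show ?thesis by linarith
  qed
  \<comment> \<open>The signs of the coordinates of \<open>c - m\<close> select the quadrant at
    \<open>m\<close> that faces the centre.\<close>
  define p where "p \<longleftrightarrow> 0 \<le> (c - m) \<bullet> u"
  define q where "q \<longleftrightarrow> 0 \<le> (c - m) \<bullet> v"
  have "z \<in> ball c r" if z: "z \<in> region a k j (Some (p, q))" for z
  proof -
    define w where "w = z - m"
    have wu: "w \<bullet> u = xcoord z - xcoord m" and wv: "w \<bullet> v = ycoord z - ycoord m"
      by (simp_all add: w_def xcoord_def ycoord_def inner_diff_left)
    have coords: "xcoord m - (if p then 0 else 3 * a) \<le> xcoord z"
        "xcoord z < xcoord m + (if p then 3 * a else 0)"
        "(if q then (real_of_int j + 1) * (a / 500) else (real_of_int j + 1) * (a / 500) - 3 * a) \<le> ycoord z"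
        "ycoord z < (if q then j * (a / 500) + 3 * a else j * (a / 500))"
      using z unfolding region_def xm rect_def option.case prod.case mem_Collect_eq by blast+
    have u_le: "\<bar>w \<bullet> u\<bar> \<le> 3 * a" "0 \<le> (w \<bullet> u) * ((c - m) \<bullet> u)"
    proof -
      have "if p then 0 \<le> w \<bullet> u \<and> w \<bullet> u \<le> 3 * a else - (3 * a) \<le> w \<bullet> u \<and> w \<bullet> u \<le> 0"
        using coords(1,2) by (simp add: wu split: if_splits)
      then show "\<bar>w \<bullet> u\<bar> \<le> 3 * a" "0 \<le> (w \<bullet> u) * ((c - m) \<bullet> u)"
        using a by (auto simp: p_def zero_le_mult_iff split: if_splits)
    qed
    have v_le: "\<bar>w \<bullet> v\<bar> \<le> 3 * a" "0 \<le> (w \<bullet> v) * ((c - m) \<bullet> v)"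
    proof -
      \<comment> \<open>The rectangle begins at the far side of the cell and ends
        \<open>3 * a\<close> beyond its near side, so these bounds hold wherever \<open>m\<close>
        lies in the cell.\<close>
      have "if q then 0 \<le> w \<bullet> v \<and> w \<bullet> v \<le> 3 * a else - (3 * a) \<le> w \<bullet> v \<and> w \<bullet> v \<le> 0"
        using coords(3,4) j by (cases q) (simp_all add: wv)
      then show "\<bar>w \<bullet> v\<bar> \<le> 3 * a" "0 \<le> (w \<bullet> v) * ((c - m) \<bullet> v)"
        using a by (auto simp: q_def zero_le_mult_iff split: if_splits)
    qed
    have "(norm w)\<^sup>2 = (w \<bullet> u)\<^sup>2 + (w \<bullet> v)\<^sup>2"
      unfolding power2_norm_eq_inner by (subst inner_frame) (simp add: power2_eq_square)
    also have "\<dots> \<le> (3 * a)\<^sup>2 + (3 * a)\<^sup>2"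
      using u_le(1) v_le(1) a by (intro add_mono abs_le_square_iff[THEN iffD1]) auto
    finally have w_le: "(norm w)\<^sup>2 \<le> 18 * a\<^sup>2" by (simp add: power2_eq_square)
    have "0 \<le> w \<bullet> (c - m)" using u_le v_le by (subst inner_frame) simp
    moreover have "(norm (z - c))\<^sup>2 = (norm (m - c))\<^sup>2 - 2 * (w \<bullet> (c - m)) + (norm w)\<^sup>2"
      by (simp add: w_def power2_norm_eq_inner algebra_simps inner_commute)
    moreover have "0 < a\<^sup>2" using a by simp
    \<comment> \<open>The inequality \<open>18 * a\<^sup>2 < 25 * a\<^sup>2\<close> keeps even the
      far corner of the rectangle inside the disk.\<close>
    ultimately have "(norm (z - c))\<^sup>2 < r\<^sup>2" using power w_le by linarith
    moreover have "0 \<le> r" using xy(1) by auto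
    ultimately show ?thesis
      by (simp add: dist_norm norm_minus_commute power2_less_imp_less)
  qed
  then have "V \<inter> region a k j (Some (p, q)) = {}" using xy(3) by blast
  then show ?thesis unfolding j_def ym by blast
qed

end

section \<open>Counting coarse paths\<close>

lemma homogeneous_poisson_processD:
  assumes hpp: "homogeneous_poisson_process M \<gamma> X"
  shows "prob_space M"
    and "\<omega> \<in> space M \<Longrightarrow> locally_finite_set (X \<omega>)"
    and "B \<in> sets borel \<Longrightarrow> bounded B \<Longrightarrow> (\<lambda>\<omega>. card (X \<omega> \<inter> B)) \<in> measurable M (count_space UNIV)"
    and "B \<in> sets borel \<Longrightarrow> bounded B \<Longrightarrow> measure M {\<omega> \<in> space M. card (X \<omega> \<inter> B) = k}
      = (\<gamma> * measure lborel B) ^ k / fact k * exp (- (\<gamma> * measure lborel B))"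
    and "finite I \<Longrightarrow> (\<And>i. i \<in> I \<Longrightarrow> C i \<in> sets borel) \<Longrightarrow> (\<And>i. i \<in> I \<Longrightarrow> bounded (C i)) \<Longrightarrow>
      disjoint_family_on C I \<Longrightarrow>
      prob_space.indep_vars M (\<lambda>_. count_space UNIV) (\<lambda>i \<omega>. card (X \<omega> \<inter> C i)) (I :: nat set)"
proof -
  note parts = hpp[unfolded homogeneous_poisson_process_def]
  note counts = parts[THEN conjunct2, THEN conjunct2, THEN conjunct1, rule_format]
  show "prob_space M" by (rule parts[THEN conjunct1])
  show "locally_finite_set (X \<omega>)" if "\<omega> \<in> space M"
    by (rule parts[THEN conjunct2, THEN conjunct1, rule_format, OF that])
  show "(\<lambda>\<omega>. card (X \<omega> \<inter> B)) \<in> measurable M (count_space UNIV)" if "B \<in> sets borel" "bounded B"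
    by (rule counts[OF that, THEN conjunct1])
  show "measure M {\<omega> \<in> space M. card (X \<omega> \<inter> B) = k}
      = (\<gamma> * measure lborel B) ^ k / fact k * exp (- (\<gamma> * measure lborel B))"
    if "B \<in> sets borel" "bounded B"
    by (rule counts[OF that, THEN conjunct2, THEN spec])
  show "prob_space.indep_vars M (\<lambda>_. count_space UNIV) (\<lambda>i \<omega>. card (X \<omega> \<inter> C i)) I"
    if "finite I" "\<And>i. i \<in> I \<Longrightarrow> C i \<in> sets borel" "\<And>i. i \<in> I \<Longrightarrow> bounded (C i)"
      "disjoint_family_on C I"
    by (rule parts[THEN conjunct2, THEN conjunct2, THEN conjunct2, rule_format]) (use that in auto)
qed

text \<open>\<open>card\<close> is also 0 on infinite sets, so local finiteness and boundedness
  enter here.\<close>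

lemma void_event_eq:
  assumes "homogeneous_poisson_process M \<gamma> X" "bounded B" "\<omega> \<in> space M"
  shows "X \<omega> \<inter> B = {} \<longleftrightarrow> card (X \<omega> \<inter> B) = 0"
  using homogeneous_poisson_processD(2)[OF assms(1,3)] assms(2) by (simp add: locally_finite_set_def)

lemma sets_void_event:
  assumes hpp: "homogeneous_poisson_process M \<gamma> X" and B: "B \<in> sets borel" "bounded B"
  shows "{\<omega> \<in> space M. X \<omega> \<inter> B = {} \<longleftrightarrow> b} \<in> sets M"
proof -
  have "(\<lambda>\<omega>. card (X \<omega> \<inter> B)) \<in> measurable M (count_space UNIV)"
    by (rule homogeneous_poisson_processD(3)[OF hpp B])
  then have "(\<lambda>\<omega>. card (X \<omega> \<inter> B)) -` {n. n = 0 \<longleftrightarrow> b} \<inter> space M \<in> sets M"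
    by (rule measurable_sets) simp
  also have "(\<lambda>\<omega>. card (X \<omega> \<inter> B)) -` {n. n = 0 \<longleftrightarrow> b} \<inter> space M = {\<omega> \<in> space M. X \<omega> \<inter> B = {} \<longleftrightarrow> b}"
    using void_event_eq[OF hpp B(2)] by blast
  finally show ?thesis .
qed

lemma prob_void:
  assumes hpp: "homogeneous_poisson_process M \<gamma> X" and B: "B \<in> sets borel" "bounded B"
  shows "measure M {\<omega> \<in> space M. X \<omega> \<inter> B = {}} = exp (- (\<gamma> * measure lborel B))"
proof -
  have "measure M {\<omega> \<in> space M. card (X \<omega> \<inter> B) = 0} =
      (\<gamma> * measure lborel B) ^ 0 / fact 0 * exp (- (\<gamma> * measure lborel B))"
    by (rule homogeneous_poisson_processD(4)[OF hpp B])
  moreover have "{\<omega> \<in> space M. X \<omega> \<inter> B = {}} = {\<omega> \<in> space M. card (X \<omega> \<inter> B) = 0}"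
    using void_event_eq[OF hpp B(2)] by blast
  ultimately show ?thesis by simp
qed

lemma prob_void_events:
  fixes B :: "nat \<Rightarrow> 'a::euclidean_space set"
  assumes hpp: "homogeneous_poisson_process M \<gamma> X"
    and B: "\<And>k. k \<in> I \<Longrightarrow> B k \<in> sets borel" "\<And>k. k \<in> I \<Longrightarrow> bounded (B k)"
    and I: "disjoint_family_on B I" "finite I" "I \<noteq> {}"
  shows "measure M {\<omega> \<in> space M. \<forall>k\<in>I. X \<omega> \<inter> B k = {} \<longleftrightarrow> b k}
    = (\<Prod>k\<in>I. measure M {\<omega> \<in> space M. X \<omega> \<inter> B k = {} \<longleftrightarrow> b k})"
proof -
  interpret prob_space M by (rule homogeneous_poisson_processD(1)[OF hpp])
  define A where "A k = {n :: nat. n = 0 \<longleftrightarrow> b k}" for k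
  have "indep_vars (\<lambda>_. count_space UNIV) (\<lambda>k \<omega>. card (X \<omega> \<inter> B k)) I"
    by (rule homogeneous_poisson_processD(5)[OF hpp I(2) B I(1)])
  then have "prob (\<Inter>k\<in>I. (\<lambda>\<omega>. card (X \<omega> \<inter> B k)) -` A k \<inter> space M)
      = (\<Prod>k\<in>I. prob ((\<lambda>\<omega>. card (X \<omega> \<inter> B k)) -` A k \<inter> space M))"
    using I by (intro indep_varsD_finite) auto
  moreover have eq: "(\<lambda>\<omega>. card (X \<omega> \<inter> B k)) -` A k \<inter> space M = {\<omega> \<in> space M. X \<omega> \<inter> B k = {} \<longleftrightarrow> b k}"
    if "k \<in> I" for k
    using void_event_eq[OF hpp B(2)[OF that]] by (auto simp: A_def)
  moreover have "(\<Inter>k\<in>I. (\<lambda>\<omega>. card (X \<omega> \<inter> B k)) -` A k \<inter> space M)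
      = {\<omega> \<in> space M. \<forall>k\<in>I. X \<omega> \<inter> B k = {} \<longleftrightarrow> b k}"
    using I(3) eq by blast
  ultimately show ?thesis by simp
qed

text \<open>Partial sums of the two-sided geometric series, whose total is 3.\<close>

lemma sum_half_power_abs:
  "(\<Sum>d = - int K..int K. (1 / 2 :: real) ^ nat \<bar>d\<bar>) = 3 - 2 * (1 / 2) ^ K"
proof (induction K)
  case (Suc K)
  have "{- int (Suc K)..int (Suc K)} = insert (- int (Suc K)) (insert (int (Suc K)) {- int K..int K})"
    by auto
  moreover have "nat (int K + 1) = Suc K" by simp
  ultimately show ?case using Suc by (simp add: add.commute[of 1])
qed simp

section \<open>Union bound over words\<close>

context orthonormal_frame
begin

text \<open>A word stores increments of the cell index, because then the sum over words factorises.
  The bounded range and the extensional functions keep the set finite.\<close>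

definition words :: "nat \<Rightarrow> (nat \<Rightarrow> int \<times> (bool \<times> bool) option) set" where
  "words N = {g \<in> {..<N} \<rightarrow>\<^sub>E {- int (2 * N)..int (2 * N)} \<times> UNIV. (\<Sum>k<N. \<bar>fst (g k)\<bar>) \<le> 2 * int N}"

definition word_event :: "'w measure \<Rightarrow> ('w \<Rightarrow> (real^2) set) \<Rightarrow> real \<Rightarrow> nat
    \<Rightarrow> (nat \<Rightarrow> int \<times> (bool \<times> bool) option) \<Rightarrow> 'w set" where
  "word_event M X a N g =
     {\<omega> \<in> space M. \<forall>k\<in>{..<N}. consistent (X \<omega>) a k (\<Sum>j<Suc k. fst (g j)) (snd (g k))}"

lemma finite_words: "finite (words N)"
  unfolding words_def by (rule finite_subset[OF Collect_restrict]) (auto intro!: finite_PiE)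

lemma sets_word_event:
  assumes "homogeneous_poisson_process M \<gamma> X"
  shows "word_event M X a N g \<in> sets M"
  unfolding word_event_def consistent_def
  by (rule sets.sets_Collect_finite_All)
    (simp_all only: sets_void_event[OF assms region_borel bounded_region] finite_lessThan)

text \<open>Bounds on the probability of one crossing at intensity \<open>1 / a\<^sup>2\<close>: a
  cell then contains 1 / 50 points on average, a rectangle at least 8.\<close>

definition weight :: "(bool \<times> bool) option \<Rightarrow> real" where
  "weight \<tau> = (if \<tau> = None then 1 / 50 else exp (- 8))"

lemma weight_nonneg: "0 \<le> weight \<tau>"
  by (simp add: weight_def)

text \<open>Since e is at least 2, the sum is at most 1 / 50 + 4 / 256. The target 1 / 24 turns the
  factor 12 per strip in the count of words into 1 / 2.\<close>

lemma sum_weight_le: "(\<Sum>\<tau>\<in>UNIV. weight \<tau>) \<le> 1 / 24"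
proof -
  have "(2 :: real) ^ 8 \<le> exp 1 ^ 8"
    using exp_ge_add_one_self[of 1] by (intro power_mono) auto
  then have "256 \<le> exp (8 :: real)" by (simp flip: exp_of_nat_mult)
  then have exp8: "exp (- 8) \<le> 1 / (256 :: real)" by (simp add: exp_minus field_simps)
  have "card (UNIV :: (bool \<times> bool) set) = 4" by (simp add: card_UNIV_bool flip: UNIV_Times_UNIV)
  then have "(\<Sum>\<tau>\<in>UNIV. weight \<tau>) = 1 / 50 + 4 * exp (- 8)"
    unfolding UNIV_option_conv by (simp add: weight_def sum.reindex)
  then show ?thesis using exp8 by simp
qed

lemma prob_consistent_le:
  assumes hpp: "homogeneous_poisson_process M \<gamma> X" and a: "0 < a" "\<gamma> * a\<^sup>2 = 1"
  shows "measure M {\<omega> \<in> space M. consistent (X \<omega>) a k c \<tau>} \<le> weight \<tau>"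
proof -
  interpret prob_space M by (rule homogeneous_poisson_processD(1)[OF hpp])
  have void: "measure M {\<omega> \<in> space M. X \<omega> \<inter> region a k c \<tau> = {}}
      = exp (- (\<gamma> * measure lborel (region a k c \<tau>)))"
    by (rule prob_void[OF hpp region_borel bounded_region])
  have "\<gamma> = 1 / a\<^sup>2" using a by (simp add: field_simps)
  then have "0 \<le> \<gamma>" by simp
  show ?thesis
  proof (cases \<tau>)
    case None
    have "{\<omega> \<in> space M. X \<omega> \<inter> region a k c None = {}} \<in> sets M"
      using sets_void_event[OF hpp region_borel bounded_region, of _ _ _ _ True] by simp
    then have "measure M {\<omega> \<in> space M. consistent (X \<omega>) a k c None}
        = 1 - exp (- (\<gamma> * (a\<^sup>2 / 50)))"
      using prob_neg[of "\<lambda>\<omega>. X \<omega> \<inter> region a k c None = {}"] void None a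
      by (simp add: consistent_def measure_region_None)
    also have "\<gamma> * (a\<^sup>2 / 50) = 1 / 50" using a by simp
    finally show ?thesis using exp_ge_add_one_self[of "- (1 / 50)"] None by (simp add: weight_def)
  next
    case (Some pq)
    have "8 = \<gamma> * (8 * a\<^sup>2)" using a(2) by simp
    also have "\<dots> \<le> \<gamma> * measure lborel (region a k c \<tau>)"
      unfolding Some by (intro mult_left_mono measure_region_Some a(1) \<open>0 \<le> \<gamma>\<close>)
    finally have "8 \<le> \<gamma> * measure lborel (region a k c \<tau>)" .
    then show ?thesis using void Some by (simp add: consistent_def weight_def)
  qed
qed

text \<open>Once the word is fixed, the regions are deterministic and disjoint, so the events of
  different strips are independent.\<close>

lemma prob_word_event_le:
  assumes hpp: "homogeneous_poisson_process M \<gamma> X" and a: "0 < a" "\<gamma> * a\<^sup>2 = 1" and N: "0 < N"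
  shows "measure M (word_event M X a N g) \<le> (\<Prod>k<N. weight (snd (g k)))"
proof -
  have "measure M (word_event M X a N g)
      = (\<Prod>k<N. measure M {\<omega> \<in> space M. consistent (X \<omega>) a k (\<Sum>j<Suc k. fst (g j)) (snd (g k))})"
    unfolding word_event_def consistent_def using N
    by (intro prob_void_events[OF hpp region_borel bounded_region disjoint_regions[OF a(1)]]) auto
  also have "\<dots> \<le> (\<Prod>k<N. weight (snd (g k)))"
    by (intro prod_mono conjI measure_nonneg prob_consistent_le[OF hpp a])
  finally show ?thesis .
qed

text \<open>Chernoff's trick: \<open>4 ^ N * (1 / 2) ^ (\<Sum>k<N. \<bar>d k\<bar>)\<close> is at least 1 on words, and summed with this
  weight the words factorise.\<close>

lemma prob_words_le:
  assumes hpp: "homogeneous_poisson_process M \<gamma> X" and a: "0 < a" "\<gamma> * a\<^sup>2 = 1" and N: "0 < N"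
  shows "measure M (\<Union>g\<in>words N. word_event M X a N g) \<le> (1 / 2) ^ N"
proof -
  interpret prob_space M by (rule homogeneous_poisson_processD(1)[OF hpp])
  define f :: "int \<times> (bool \<times> bool) option \<Rightarrow> real"
    where "f x = 4 * (1 / 2) ^ nat \<bar>fst x\<bar> * weight (snd x)" for x
  define D :: "(int \<times> (bool \<times> bool) option) set" where "D = {- int (2 * N)..int (2 * N)} \<times> UNIV"
  have f_nonneg: "0 \<le> f x" for x by (simp add: f_def weight_nonneg)
  have fin: "finite ({..<N} \<rightarrow>\<^sub>E D)" unfolding D_def by (auto intro!: finite_PiE)
  have word: "measure M (word_event M X a N g) \<le> (\<Prod>k<N. f (g k))" if "g \<in> words N" for g
  proof -
    have "int (\<Sum>k<N. nat \<bar>fst (g k)\<bar>) \<le> int (2 * N)" using that by (simp add: words_def)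
    then have "(\<Sum>k<N. nat \<bar>fst (g k)\<bar>) \<le> 2 * N" by linarith
    then have "(1 / 2 :: real) ^ (2 * N) \<le> (1 / 2) ^ (\<Sum>k<N. nat \<bar>fst (g k)\<bar>)"
      by (intro power_decreasing) auto
    then have "4 ^ N * (1 / 2 :: real) ^ (2 * N) \<le> 4 ^ N * (1 / 2) ^ (\<Sum>k<N. nat \<bar>fst (g k)\<bar>)"
      by (intro mult_left_mono) auto
    also have "4 ^ N * (1 / 2 :: real) ^ (2 * N) = 1"
      by (simp add: power_mult power_one_over flip: power_mult_distrib)
    finally have "1 * (\<Prod>k<N. weight (snd (g k)))
        \<le> 4 ^ N * (1 / 2) ^ (\<Sum>k<N. nat \<bar>fst (g k)\<bar>) * (\<Prod>k<N. weight (snd (g k)))"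
      by (intro mult_right_mono prod_nonneg weight_nonneg ballI)
    also have "\<dots> = (\<Prod>k<N. f (g k))"
      by (simp add: f_def prod.distrib power_sum)
    finally show ?thesis using prob_word_event_le[OF hpp a N, of g] by simp
  qed
  have "measure M (\<Union>g\<in>words N. word_event M X a N g) \<le> (\<Sum>g\<in>words N. measure M (word_event M X a N g))"
    using sets_word_event[OF hpp] finite_words by (intro finite_measure_subadditive_finite) auto
  also have "\<dots> \<le> (\<Sum>g\<in>words N. \<Prod>k<N. f (g k))" by (intro sum_mono word)
  \<comment> \<open>Dropping the constraint on the variation leaves a full function space, over
    which a sum of products is a product of sums.\<close>
  also have "\<dots> \<le> (\<Sum>g\<in>{..<N} \<rightarrow>\<^sub>E D. \<Prod>k<N. f (g k))"
    using fin by (intro sum_mono2) (auto simp: words_def D_def intro!: prod_nonneg f_nonneg)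
  also have "\<dots> = (\<Prod>k<N. \<Sum>x\<in>D. f x)"
    by (rule prod_sum_PiE[symmetric]) (auto simp: D_def)
  also have "\<dots> = (\<Sum>x\<in>D. f x) ^ N" by simp
  finally have "measure M (\<Union>g\<in>words N. word_event M X a N g) \<le> (\<Sum>x\<in>D. f x) ^ N" .
  moreover have "(\<Sum>x\<in>D. f x) \<le> 1 / 2"
  proof -
    have "(1 / 2 :: real) ^ (2 * N) \<le> 1" by (intro power_le_one) auto
    then have S: "0 \<le> 3 - 2 * (1 / 2 :: real) ^ (2 * N)" "3 - 2 * (1 / 2 :: real) ^ (2 * N) \<le> 3" by auto
    have "(\<Sum>x\<in>D. f x) = 4 * ((\<Sum>d = - int (2 * N)..int (2 * N). (1 / 2) ^ nat \<bar>d\<bar>) * (\<Sum>\<tau>\<in>UNIV. weight \<tau>))"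
      unfolding D_def f_def mult.assoc sum_product sum.cartesian_product
      by (simp add: sum_distrib_left case_prod_unfold)
    \<comment> \<open>The 4 is Chernoff's factor, the 3 bounds the geometric sum, and 1 / 24 bounds
      the sum of the weights.\<close>
    also have "\<dots> \<le> 4 * (3 * (1 / 24))"
      unfolding sum_half_power_abs
      by (intro mult_left_mono mult_mono S sum_weight_le sum_nonneg weight_nonneg) auto
    finally show ?thesis by simp
  qed
  then have "(\<Sum>x\<in>D. f x) ^ N \<le> (1 / 2) ^ N"
    by (intro power_mono sum_nonneg f_nonneg)
  ultimately show ?thesis by linarith
qed

section \<open>From a short path to a word\<close>

text \<open>The path gains \<open>xcoord t\<close> along \<open>u\<close>, so by Pythagoras its
  shortness leaves a variation of at most \<open>N * (a / 500)\<close> across. The path is sampled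
  once per strip, and \<open>c\<close> and \<open>\<tau>\<close> are read off from the
  samples.\<close>

lemma coarse_path:
  fixes Z :: "(real^2) list"
  assumes a: "0 < a" and N: "10 * a * (real N + 1) \<le> xcoord t"
    and Z: "Del_path (X \<union> {s, t}) s t Z"
    and short: "(polyline_length Z)\<^sup>2 \<le> (xcoord t)\<^sup>2 + (N * (a / 500))\<^sup>2"
  obtains c :: "nat \<Rightarrow> int" and \<tau>
  where "c 0 = 0" "(\<Sum>k<N. \<bar>c (Suc k) - c k\<bar>) \<le> 2 * N"
    "\<forall>k<N. consistent X a k (c (Suc k)) (\<tau> k)"
proof -
  define m where "m = length Z - 1"
  define x where "x i = xcoord (Z ! i)" for i
  define y where "y i = ycoord (Z ! i)" for i
  have "Z ! 0 = s" "Z ! m = t"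
    using Z by (auto simp: Del_path_def m_def hd_conv_nth last_conv_nth)
  then have x0: "x 0 = 0" and xm: "x m = xcoord t" and y0: "y 0 = 0"
    by (simp_all add: x_def y_def xcoord_def ycoord_def)
  have t_pos: "0 < xcoord t" using a N by (smt (verit) mult_pos_pos of_nat_0_le_iff)
  have y_var: "(\<Sum>i<m. \<bar>y (Suc i) - y i\<bar>) \<le> N * (a / 500)"
  proof -
    have "xcoord t = (\<Sum>i<m. x (Suc i) - x i)"
      by (simp add: sum_lessThan_telescope x0 xm)
    also have "\<dots> \<le> (\<Sum>i<m. \<bar>x (Suc i) - x i\<bar>)" by (intro sum_mono) simp
    finally have "(xcoord t)\<^sup>2 \<le> (\<Sum>i<m. \<bar>x (Suc i) - x i\<bar>)\<^sup>2"
      using t_pos by (intro power_mono) auto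
    then have "(\<Sum>i<m. \<bar>y (Suc i) - y i\<bar>)\<^sup>2 \<le> (N * (a / 500))\<^sup>2"
      using polyline_length_ge[of Z] short by (simp add: x_def y_def m_def)
    moreover have "0 \<le> N * (a / 500)" using a by simp
    ultimately show ?thesis by (rule power2_le_imp_le)
  qed

  \<comment> \<open>Vertex \<open>i k\<close> is the first one to reach the right side of strip
    \<open>k\<close>; the edge leading to it either starts inside the strip or spans it.\<close>
  define i where "i k = (LEAST i. 10 * a * (real k + 2) \<le> x i)" for k :: nat
  have strip_le: "10 * a * (real k + 2) \<le> xcoord t" if "k < N" for k :: nat
  proof -
    have "10 * a * (real k + 2) \<le> 10 * a * (real N + 1)" using a that by (intro mult_left_mono) auto
    then show ?thesis using N by linarith
  qed
  have i_ge: "10 * a * (real k + 2) \<le> x (i k)" and i_le: "i k \<le> m" if "k < N" for k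
  proof -
    have "10 * a * (real k + 2) \<le> x m" using strip_le[OF that] xm by simp
    then show "10 * a * (real k + 2) \<le> x (i k)" "i k \<le> m"
      unfolding i_def by (rule LeastI, rule Least_le)
  qed
  have before_i: "x j < 10 * a * (real k + 2)" if "j < i k" for j k
    using not_less_Least[of j "\<lambda>i. 10 * a * (real k + 2) \<le> x i"] that unfolding i_def by auto
  have i_pos: "0 < i k" if "k < N" for k
  proof (rule ccontr)
    assume "\<not> 0 < i k"
    then have "10 * a * (real k + 2) \<le> 0" using i_ge[OF that] x0 by simp
    then show False using a by (simp add: mult_le_0_iff)
  qed

  \<comment> \<open>Sample 0 is \<open>s\<close>. Sample \<open>Suc k\<close> belongs to strip
    \<open>k\<close>: it is the starting vertex of the edge if this lies in the strip, and otherwise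
    the crossing with the axis.\<close>
  define e where "e k = (case k of 0 \<Rightarrow> 0 | Suc k \<Rightarrow> i k - 1)" for k
  define \<theta> where "\<theta> k = (case k of 0 \<Rightarrow> 0 | Suc k \<Rightarrow> if 10 * a * (real k + 1) \<le> x (i k - 1) then 0
    else (10 * a * (real k + 1) + 5 * a - x (i k - 1)) / (x (i k) - x (i k - 1)))" for k
  define P where "P k = y (e k) + \<theta> k * (y (Suc (e k)) - y (e k))" for k
  define c where "c k = \<lfloor>P k / (a / 500)\<rfloor>" for k

  have m_pos: "0 < m" using x0 xm t_pos by (cases m) auto
  have "(\<Sum>k<N. \<bar>P (Suc k) - P k\<bar>) \<le> (\<Sum>i<m. \<bar>y (Suc i) - y i\<bar>)"
    unfolding P_def
  proof (rule sampled_variation_le)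
    fix k assume k: "k \<le> N"
    show "0 \<le> \<theta> k \<and> \<theta> k \<le> 1"
    proof (cases k)
      case (Suc j)
      have "10 * a * (real j + 2) \<le> x (i j)" using i_ge k Suc by simp
      then show ?thesis
        using a by (auto simp: \<theta>_def Suc divide_simps algebra_simps)
    qed (simp add: \<theta>_def)
    show "e k < m"
    proof (cases k)
      case (Suc j)
      then show ?thesis using i_le[of j] i_pos[of j] k by (simp add: e_def)
    qed (simp add: e_def m_pos)
  next
    fix k assume k: "k < N"
    show "e k < e (Suc k) \<or> e k = e (Suc k) \<and> \<theta> k \<le> \<theta> (Suc k)"
    proof (cases k)
      case 0
      have "0 \<le> \<theta> (Suc 0)"
        using i_ge[of 0] a k 0 by (auto simp: \<theta>_def divide_simps)
      then show ?thesis using 0 by (auto simp: e_def \<theta>_def)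
    next
      case (Suc j)
      have "10 * a * (real j + 2) \<le> x (i k)"
        using i_ge[OF k] a Suc by (simp add: algebra_simps)
      then have le: "i j \<le> i k" unfolding i_def[of j] by (intro Least_le) simp
      \<comment> \<open>Here one edge serves two successive strips. It starts to the left of strip
        \<open>k\<close>, so the later sample is a crossing with the axis, not before the earlier
        sample.\<close>
      have "\<theta> k \<le> \<theta> (Suc k)" if eq: "i j = i k"
      proof -
        define b where "b = x (i k - 1)"
        have b: "b < 10 * a * (real k + 1)"
          using before_i[of "i j - 1" j] i_pos[of j] k Suc eq by (simp add: add.commute b_def)
        have pos: "0 < x (i k) - b"
        proof -
          have "10 * a * (real k + 1) \<le> 10 * a * (real k + 2)" using a by simp
          then show ?thesis using b i_ge[OF k] by linarith
        qed
        have "\<theta> (Suc k) = (10 * a * (real k + 1) + 5 * a - b) / (x (i k) - b)"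
          using b by (simp add: \<theta>_def b_def)
        moreover have "\<theta> k \<le> (10 * a * (real k + 1) + 5 * a - b) / (x (i k) - b)"
        proof (cases "10 * a * (real j + 1) \<le> b")
          case True
          then have "\<theta> k = 0" by (simp add: \<theta>_def Suc eq b_def)
          then show ?thesis using a b pos by simp
        next
          case False
          then have "\<theta> k = (10 * a * (real j + 1) + 5 * a - b) / (x (i k) - b)"
            by (simp add: \<theta>_def Suc eq b_def)
          also have "\<dots> \<le> (10 * a * (real k + 1) + 5 * a - b) / (x (i k) - b)"
            using a pos Suc by (intro divide_right_mono) auto
          finally show ?thesis .
        qed
        ultimately show ?thesis by linarith
      qed
      then show ?thesis
        using le i_pos[of j] k Suc by (auto simp: e_def)
    qed
  qed
  with y_var have P_var: "(\<Sum>k<N. \<bar>P (Suc k) - P k\<bar>) \<le> N * (a / 500)" by linarith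

  have c_var: "(\<Sum>k<N. \<bar>c (Suc k) - c k\<bar>) \<le> 2 * int N"
  proof -
    \<comment> \<open>Rounding to cells costs at most 1 per strip, which raises the bound from
      \<open>N\<close> to \<open>2 * N\<close>.\<close>
    have floor: "real_of_int \<bar>\<lfloor>p\<rfloor> - \<lfloor>q\<rfloor>\<bar> \<le> \<bar>p - q\<bar> + 1" for p q :: real by linarith
    have "real_of_int \<bar>c (Suc k) - c k\<bar> \<le> \<bar>P (Suc k) - P k\<bar> / (a / 500) + 1" for k
    proof -
      have "\<bar>P (Suc k) / (a / 500) - P k / (a / 500)\<bar> = \<bar>P (Suc k) - P k\<bar> / (a / 500)"
        using a unfolding diff_divide_distrib[symmetric] abs_divide by simp
      then show ?thesis
        using floor[of "P (Suc k) / (a / 500)" "P k / (a / 500)"] unfolding c_def by (simp only:)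
    qed
    then have "(\<Sum>k<N. real_of_int \<bar>c (Suc k) - c k\<bar>) \<le> (\<Sum>k<N. \<bar>P (Suc k) - P k\<bar> / (a / 500) + 1)"
      by (intro sum_mono)
    also have "\<dots> = (\<Sum>k<N. \<bar>P (Suc k) - P k\<bar>) / (a / 500) + N"
      by (simp only: sum.distrib sum_divide_distrib) simp
    also have "\<dots> \<le> 2 * N" using P_var a by (simp add: field_simps)
    finally have "real_of_int (\<Sum>k<N. \<bar>c (Suc k) - c k\<bar>) \<le> real_of_int (2 * int N)" by simp
    then show ?thesis by (simp only: of_int_le_iff)
  qed

  have "\<exists>\<tau>. consistent X a k (c (Suc k)) \<tau>" if k: "k < N" for k
  proof -
    define j where "j = i k - 1"
    have j: "Suc j = i k" using i_pos[OF k] by (simp add: j_def)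
    have c_eq: "c (Suc k) = \<lfloor>(y j + \<theta> (Suc k) * (y (Suc j) - y j)) / (a / 500)\<rfloor>"
      by (simp add: c_def P_def e_def j_def)
    have "j < length Z" "Suc j < length Z"
      using i_le[OF k] j m_pos by (auto simp: m_def)
    have xj: "x j < 10 * a * (real k + 2)" using before_i[of j k] j by simp
    show ?thesis
    proof (cases "10 * a * (real k + 1) \<le> x j")
      case True
      \<comment> \<open>All strips lie strictly to the right of \<open>s\<close> and to the left of
        \<open>t\<close>, so a vertex in a strip is a point of \<open>X\<close>.\<close>
      then have "0 < x j" using a by (smt (verit) mult_pos_pos of_nat_0_le_iff)
      moreover have "x j < xcoord t" using xj strip_le[OF k] by linarith
      ultimately have "Z ! j \<noteq> s" "Z ! j \<noteq> t" by (auto simp: x_def xcoord_def)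
      moreover have "Z ! j \<in> X \<union> {s, t}"
        using Del_path_vertices[OF Z] nth_mem[OF \<open>j < length Z\<close>] by blast
      ultimately have "Z ! j \<in> X" by blast
      moreover have "c (Suc k) = \<lfloor>y j / (a / 500)\<rfloor>"
        using True by (simp add: c_eq \<theta>_def j_def)
      then have "c (Suc k) \<le> y j / (a / 500)" "y j / (a / 500) < real_of_int (c (Suc k)) + 1"
        by linarith+
      then have "c (Suc k) * (a / 500) \<le> y j" "y j < (real_of_int (c (Suc k)) + 1) * (a / 500)"
        using a by (simp_all add: field_simps)
      then have "Z ! j \<in> region a k (c (Suc k)) None"
        using True xj by (simp add: region_def rect_def x_def y_def)
      ultimately have "consistent X a k (c (Suc k)) None"
        by (auto simp: consistent_def)
      then show ?thesis ..
    next
      case False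
      have "closed_segment (Z ! j) (Z ! Suc j) \<in> Del (X \<union> {s, t})"
        using Z \<open>Suc j < length Z\<close> successively_nth unfolding Del_path_def by fast
      then obtain b r where br: "dist b (Z ! j) = r" "dist b (Z ! Suc j) = r"
        "ball b r \<inter> (X \<union> {s, t}) = {}"
        by (rule Del_edge)
      have cross: "xcoord (Z ! j) \<le> 10 * a * (real k + 1)" "10 * a * (real k + 2) \<le> xcoord (Z ! Suc j)"
        using False i_ge[OF k] j by (simp_all add: x_def)
      have \<theta>: "\<theta> (Suc k) = (10 * a * (real k + 1) + 5 * a - xcoord (Z ! j)) / (xcoord (Z ! Suc j) - xcoord (Z ! j))"
        using False by (simp add: \<theta>_def x_def j[symmetric])
      obtain pq where "(X \<union> {s, t}) \<inter> region a k (c (Suc k)) (Some pq) = {}"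
        using crossing_edge_empty_region[OF a br cross \<theta>] unfolding c_eq y_def by (elim exE)
      then have "consistent X a k (c (Suc k)) (Some pq)"
        by (auto simp: consistent_def)
      then show ?thesis ..
    qed
  qed
  then obtain \<tau> where \<tau>: "\<forall>k<N. consistent X a k (c (Suc k)) (\<tau> k)" by metis
  have c0: "c 0 = 0" by (simp add: c_def P_def e_def \<theta>_def y0)
  show ?thesis by (rule that[OF c0 c_var \<tau>])
qed

text \<open>As the path starts in cell 0, the cell indices are recovered from their increments by
  telescoping.\<close>

lemma short_Del_path_in_words:
  fixes X :: "'w \<Rightarrow> (real^2) set"
  assumes a: "0 < a" and N: "10 * a * (real N + 1) \<le> xcoord t" and \<omega>: "\<omega> \<in> space M"
    and Z: "Del_path (X \<omega> \<union> {s, t}) s t Z"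
    and short: "(polyline_length Z)\<^sup>2 \<le> (xcoord t)\<^sup>2 + (N * (a / 500))\<^sup>2"
  shows "\<omega> \<in> (\<Union>g\<in>words N. word_event M X a N g)"
proof -
  obtain c \<tau> where c0: "c 0 = (0 :: int)" and var: "(\<Sum>k<N. \<bar>c (Suc k) - c k\<bar>) \<le> 2 * int N"
    and \<tau>: "\<forall>k<N. consistent (X \<omega>) a k (c (Suc k)) (\<tau> k)"
    by (rule coarse_path[OF a N Z short])
  define g where "g = (\<lambda>k\<in>{..<N}. (c (Suc k) - c k, \<tau> k))"
  have g: "fst (g k) = c (Suc k) - c k" "snd (g k) = \<tau> k" if "k < N" for k
    using that by (simp_all add: g_def)
  have sum_g: "(\<Sum>k<N. \<bar>fst (g k)\<bar>) = (\<Sum>k<N. \<bar>c (Suc k) - c k\<bar>)"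
    by (intro sum.cong) (auto simp: g)
  have le: "\<bar>fst (g k)\<bar> \<le> 2 * int N" if "k < N" for k
  proof -
    have "\<bar>fst (g k)\<bar> \<le> (\<Sum>k<N. \<bar>fst (g k)\<bar>)" using that by (intro member_le_sum) auto
    then show ?thesis using sum_g var by simp
  qed
  have "g k \<in> {- int (2 * N)..int (2 * N)} \<times> UNIV" if "k < N" for k
    using le[OF that] by (auto simp: mem_Times_iff abs_le_iff)
  moreover have "g \<in> extensional {..<N}" by (simp add: g_def)
  ultimately have "g \<in> words N"
    using sum_g var by (simp add: words_def PiE_def Pi_def)
  moreover have "\<omega> \<in> word_event M X a N g"
  proof -
    have "(\<Sum>j<Suc k. fst (g j)) = c (Suc k)" if "k < N" for k
    proof -
      have "(\<Sum>j<Suc k. fst (g j)) = (\<Sum>j<Suc k. c (Suc j) - c j)"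
        using that by (intro sum.cong) (auto simp: g)
      then show ?thesis using c0 by (simp only: sum_lessThan_telescope)
    qed
    then show ?thesis using \<omega> \<tau> g(2) by (simp add: word_event_def del: sum.lessThan_Suc)
  qed
  ultimately show ?thesis by blast
qed

section \<open>Lower bound for the expected length\<close>

lemma not_collinear_off_axis:
  assumes "{s, t, z} \<subseteq> V" "s \<noteq> t" "ycoord t = 0" "ycoord z \<noteq> 0"
  shows "\<not> collinear V"
proof
  assume "collinear V"
  then obtain p w where "\<And>x. x \<in> V \<Longrightarrow> \<exists>\<alpha>. x = p + \<alpha> *\<^sub>R w" by (auto simp: collinear_alt)
  then obtain \<alpha> \<beta> \<gamma> where eq: "s = p + \<alpha> *\<^sub>R w" "t = p + \<beta> *\<^sub>R w" "z = p + \<gamma> *\<^sub>R w"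
    using assms(1) by (metis insert_subset)
  then have "t - s = (\<beta> - \<alpha>) *\<^sub>R w" "z - s = (\<gamma> - \<alpha>) *\<^sub>R w" by (simp_all add: algebra_simps)
  then have "ycoord t = (\<beta> - \<alpha>) * (w \<bullet> v)" "ycoord z = (\<gamma> - \<alpha>) * (w \<bullet> v)"
    by (simp_all add: ycoord_def)
  moreover have "\<beta> \<noteq> \<alpha>" using eq assms(2) by auto
  ultimately show False using assms(3,4) by simp
qed

text \<open>Outside the unlikely events \<open>W\<close>, that some word is realised, and
  \<open>R\<close>, a shortest path exists and is long; elsewhere the integrand is bounded below by
  0.\<close>

lemma expectation_shortest_path_ge:
  assumes hpp: "homogeneous_poisson_process M \<gamma> X" and a: "0 < a" "\<gamma> * a\<^sup>2 = 1" and N: "0 < N"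
    and t: "xcoord t = norm (t - s)" "ycoord t = 0" "s \<noteq> t"
    and strips: "10 * a * (real N + 1) \<le> norm (t - s)" "norm (t - s) / 20000 \<le> N * (a / 500)"
  shows "ennreal ((1 + 1 / 10 ^ 9) * (1 - (1 / 2) ^ N - exp (- (\<gamma> * (norm (t - s))\<^sup>2))))
    \<le> (\<integral>\<^sup>+\<omega>. ennreal (polyline_length (shortest_path (X \<omega> \<union> {s, t}) s t) / norm (s - t)) \<partial>M)"
proof -
  interpret prob_space M by (rule homogeneous_poisson_processD(1)[OF hpp])
  define d where "d = norm (t - s)"
  have d: "0 < d" using t(3) by (simp add: d_def)
  define W where "W = (\<Union>g\<in>words N. word_event M X a N g)"
  \<comment> \<open>A point in this square of side \<open>d\<close> lies off the axis through
    \<open>s\<close> and \<open>t\<close> and so prevents collinearity.\<close>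
  define R where "R = {\<omega> \<in> space M. X \<omega> \<inter> rect 0 d d (2 * d) = {}}"
  have W: "W \<in> sets M" "measure M W \<le> (1 / 2) ^ N"
    unfolding W_def using finite_words sets_word_event[OF hpp]
    by (auto intro!: sets.finite_UN prob_words_le[OF hpp a N])
  have R: "R \<in> sets M"
    using sets_void_event[OF hpp rect_borel bounded_rect, of _ _ _ _ True] by (simp add: R_def)
  have "measure lborel (rect 0 d d (2 * d)) = d\<^sup>2"
    using d by (subst measure_rect) (auto simp: power2_eq_square)
  then have R_le: "measure M R = exp (- (\<gamma> * d\<^sup>2))"
    unfolding R_def by (simp add: prob_void[OF hpp rect_borel bounded_rect])
  define G where "G = space M - (W \<union> R)"
  have G: "G \<in> sets M" using W R by (simp add: G_def)
  have "measure M (W \<union> R) \<le> (1 / 2) ^ N + exp (- (\<gamma> * d\<^sup>2))"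
    using measure_Un_le[OF W(1) R] W(2) R_le by linarith
  then have prob_G: "1 - (1 / 2) ^ N - exp (- (\<gamma> * d\<^sup>2)) \<le> measure M G"
    using prob_compl[of "W \<union> R"] W(1) R by (simp add: G_def)
  have long: "1 + 1 / 10 ^ 9 \<le> polyline_length (shortest_path (X \<omega> \<union> {s, t}) s t) / norm (s - t)"
    if \<omega>: "\<omega> \<in> G" for \<omega>
  proof -
    define V where "V = X \<omega> \<union> {s, t}"
    define Z where "Z = shortest_path V s t"
    have \<omega>M: "\<omega> \<in> space M" and "\<omega> \<notin> W" "\<omega> \<notin> R" using \<omega> by (auto simp: G_def)
    then obtain z where z: "z \<in> X \<omega>" "z \<in> rect 0 d d (2 * d)" by (auto simp: R_def)
    have "ycoord z \<noteq> 0" using z(2) d by (auto simp: rect_def)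
    then have "\<not> collinear V"
      using not_collinear_off_axis[of t z V] z(1) t by (auto simp: V_def)
    moreover have "locally_finite_set V"
      using homogeneous_poisson_processD(2)[OF hpp \<omega>M]
      by (simp add: locally_finite_set_def V_def Int_Un_distrib2 del: Un_insert_right)
    ultimately have "Del_path V s t Z"
      unfolding Z_def by (intro Del_path_shortest_path) (auto simp: V_def)
    then have "\<not> (polyline_length Z)\<^sup>2 \<le> d\<^sup>2 + (N * (a / 500))\<^sup>2"
      using short_Del_path_in_words[OF a(1) _ \<omega>M, of N t X Z] \<open>\<omega> \<notin> W\<close> strips(1) t(1)
      by (auto simp: V_def W_def d_def)
    moreover have "(d / 20000)\<^sup>2 \<le> (N * (a / 500))\<^sup>2"
      using strips(2) d by (intro power_mono) (auto simp: d_def)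
    \<comment> \<open>In units of \<open>d\<^sup>2\<close>, the excess over 1 is about 2 / 10 ^ 9 on
      the left and 2.5 / 10 ^ 9 on the right.\<close>
    moreover have "((1 + 1 / 10 ^ 9) * d)\<^sup>2 \<le> d\<^sup>2 + (d / 20000)\<^sup>2"
      by (simp add: power2_eq_square algebra_simps)
    ultimately have "((1 + 1 / 10 ^ 9) * d)\<^sup>2 \<le> (polyline_length Z)\<^sup>2" by linarith
    then have "(1 + 1 / 10 ^ 9) * d \<le> polyline_length Z"
      by (rule power2_le_imp_le) (rule polyline_length_nonneg)
    then show ?thesis
      using d by (simp add: Z_def V_def d_def norm_minus_commute field_simps)
  qed
  have "ennreal ((1 + 1 / 10 ^ 9) * (1 - (1 / 2) ^ N - exp (- (\<gamma> * d\<^sup>2)))) \<le> ennreal ((1 + 1 / 10 ^ 9) * measure M G)"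
    using prob_G by (intro ennreal_leI mult_left_mono) auto
  also have "\<dots> = ennreal (1 + 1 / 10 ^ 9) * emeasure M G"
    unfolding emeasure_eq_measure by (rule ennreal_mult) (simp_all add: measure_nonneg)
  also have "\<dots> = (\<integral>\<^sup>+\<omega>. ennreal (1 + 1 / 10 ^ 9) * indicator G \<omega> \<partial>M)"
    using G by (rule nn_integral_cmult_indicator[symmetric])
  also have "\<dots> \<le> (\<integral>\<^sup>+\<omega>. ennreal (polyline_length (shortest_path (X \<omega> \<union> {s, t}) s t) / norm (s - t)) \<partial>M)"
    using long by (intro nn_integral_mono) (auto simp: indicator_def intro!: ennreal_leI)
  finally show ?thesis by (simp only: d_def)
qed

end

section \<open>Letting the intensity tend to infinity\<close>

theorem corollary2:
  fixes s t :: "real^2"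
    and M :: "nat \<Rightarrow> 'w measure"
    and X :: "nat \<Rightarrow> 'w \<Rightarrow> (real^2) set"
  assumes "s \<noteq> t"
    and "\<And>n. homogeneous_poisson_process (M n) (real n) (X n)"
  shows "liminf (\<lambda>n. \<integral>\<^sup>+\<omega>.
           ennreal (polyline_length (shortest_path (X n \<omega> \<union> {s, t}) s t) / norm (s - t)) \<partial>M n)
         \<ge> ennreal (1 + 2.47 / 10 ^ 11)"
proof (rule Liminf_bounded)
  define d where "d = norm (t - s)"
  define u where "u = (1 / d) *\<^sub>R (t - s)"
  define v :: "real^2" where "v = vector [- u $ 2, u $ 1]"
  have d: "0 < d" using assms(1) by (simp add: d_def)
  have u: "norm u = 1" using d by (simp add: u_def d_def)
  have "v \<bullet> v = u \<bullet> u" "u \<bullet> v = 0"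
    by (simp_all add: v_def inner_vec_def sum_2 vector_2)
  then interpret orthonormal_frame s u v
    using u by unfold_locales (simp_all add: norm_eq_1)
  have ts: "t - s = d *\<^sub>R u" using d by (simp add: u_def)
  then have t: "xcoord t = norm (t - s)" "ycoord t = 0"
    unfolding xcoord_def ycoord_def d_def[symmetric] unfolding ts by simp_all
  \<comment> \<open>With \<open>a = 1 / sqrt n\<close>, this many strips of width
    \<open>10 * a\<close> cover about half the distance, which leaves room for the gap before the
    first strip.\<close>
  define N where "N n = nat \<lfloor>d * sqrt (real n) / 20\<rfloor>" for n
  define g where "g n = (1 + 1 / 10 ^ 9) * (1 - (1 / 2) ^ N n - exp (- (real n * d\<^sup>2)))" for n
  have sqrt_top: "filterlim (\<lambda>n. sqrt (real n)) at_top sequentially"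
    by (rule filterlim_compose[OF sqrt_at_top filterlim_real_sequentially])
  have "filterlim (\<lambda>n. d * sqrt (real n) / 20) at_top sequentially"
    using filterlim_tendsto_pos_mult_at_top[OF tendsto_const _ sqrt_top, of "d / 20"] d by simp
  then have "filterlim N sequentially sequentially"
    unfolding N_def
    by (intro filterlim_compose[OF filterlim_nat_sequentially] filterlim_compose[OF filterlim_floor_sequentially])
  then have "(\<lambda>n. (1 / 2 :: real) ^ N n) \<longlonglongrightarrow> 0"
    by (rule filterlim_compose[rotated]) (intro LIMSEQ_realpow_zero; simp)
  moreover have "filterlim (\<lambda>n. real n * d\<^sup>2) at_top sequentially"
    using d by (intro filterlim_at_top_mult_tendsto_pos[OF tendsto_const] filterlim_real_sequentially) simp
  then have "(\<lambda>n. exp (- (real n * d\<^sup>2))) \<longlonglongrightarrow> 0"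
    by (intro filterlim_compose[OF exp_at_bot] filterlim_compose[OF filterlim_uminus_at_bot_at_top])
  ultimately have "g \<longlonglongrightarrow> (1 + 1 / 10 ^ 9) * (1 - 0 - 0)"
    unfolding g_def by (intro tendsto_intros)
  \<comment> \<open>The limit \<open>1 + 1 / 10 ^ 9\<close> strictly exceeds the claimed constant,
    which absorbs the vanishing error terms.\<close>
  then have "\<forall>\<^sub>F n in sequentially. 1 + 2.47 / 10 ^ 11 < g n"
    by (rule order_tendstoD) simp
  \<comment> \<open>Then \<open>d * sqrt (real n) / 20\<close> is at least 2, so rounding it down to
    \<open>N n\<close> loses at most half of it.\<close>
  moreover have "\<forall>\<^sub>F n in sequentially. 40 / d \<le> sqrt (real n)"
    using sqrt_top unfolding filterlim_at_top by blast
  moreover have "\<forall>\<^sub>F n in sequentially. 0 < n" by (rule eventually_gt_at_top)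
  ultimately show "\<forall>\<^sub>F n in sequentially. ennreal (1 + 2.47 / 10 ^ 11) \<le> (\<integral>\<^sup>+\<omega>.
      ennreal (polyline_length (shortest_path (X n \<omega> \<union> {s, t}) s t) / norm (s - t)) \<partial>M n)"
  proof eventually_elim
    case (elim n)
    define a where "a = 1 / sqrt (real n)"
    have a: "0 < a" "real n * a\<^sup>2 = 1" using elim(3) by (simp_all add: a_def power_divide)
    have large: "40 \<le> d * sqrt (real n)" using elim(2) d by (simp add: field_simps)
    have N_le: "real (N n) \<le> d * sqrt (real n) / 20" "d * sqrt (real n) / 20 < real (N n) + 1"
      using large unfolding N_def by linarith+
    have d_eq: "(d * sqrt (real n)) * a = d" using elim(3) by (simp add: a_def)
    have "10 * (real (N n) + 1) * a \<le> (d * sqrt (real n)) * a"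
      using N_le large a(1) by (intro mult_right_mono) auto
    moreover have "(d * sqrt (real n)) * a \<le> 40 * real (N n) * a"
      using N_le large a(1) by (intro mult_right_mono) auto
    ultimately have strips: "10 * a * (real (N n) + 1) \<le> d" "d / 20000 \<le> real (N n) * (a / 500)"
      unfolding d_eq by (simp_all add: algebra_simps)
    have "0 < N n" using N_le(2) large by linarith
    then have "ennreal (g n) \<le> (\<integral>\<^sup>+\<omega>.
        ennreal (polyline_length (shortest_path (X n \<omega> \<union> {s, t}) s t) / norm (s - t)) \<partial>M n)"
      unfolding g_def d_def
      by (intro expectation_shortest_path_ge[OF assms(2) a _ t assms(1)] strips[unfolded d_def])
    then show ?case using elim(1) by (meson ennreal_leI less_imp_le order_trans)
  qed
qed

end
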